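(* Let $0\le a<b<\infty$, $\Delta=[a,b]$, let $\Phi\in C^1(\Delta,\mathbb R)$ be increasing with $\Phi'(\ell)\neq 0$ for all $\ell\in\Delta$, let $0<\kappa<\mu\le 1$ and $\omega>0$. Let $\mathbb F:\Delta\times\mathbb R\to\mathbb R$ be continuous and suppose there is a constant $L>0$ such that $|\mathbb F(\ell,y)-\mathbb F(\ell,x)|\le L|y-x|$ for all $x,y\in\mathbb R$ and $\ell\in\Delta$. Let $\mathfrak z_a,\bar{\mathfrak z}_a\in\mathbb R$ and suppose $\mathfrak z$ and $\bar{\mathfrak z}$ are solutions of $$ {}^c\mathbb D_{a^+}^{\mu;\Phi}\mathfrak z(\ell)+\omega\,{}^c\mathbb D_{a^+}^{\kappa;\Phi}\mathfrak z(\ell)=\mathbb F(\ell,\mathfrak z(\ell)),\quad \ell\in\Delta, $$ corresponding to the initial conditions $\mathfrak z(a)=\mathfrak z_a$ and $\bar{\mathfrak z}(a)=\bar{\mathfrak z}_a$, respectively. Then $$ \|\mathfrak z-\bar{\mathfrak z}\|\le \mathbb E_{\mu}\bigl(L(\Phi(b)-\Phi(a))^{\mu}\bigr)\,|\mathfrak z_a-\bar{\mathfrak z}_a|, $$ where $\|\cdot\|$ is the supremum norm on $C(\Delta,\mathbb R)$.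
   Context: For $\alpha>0$ and integrable $\mathfrak z:\Delta\to\mathbb R$, the $\Phi$-Riemann–Liouville integral is $\mathbb I_{a^+}^{\alpha;\Phi}\mathfrak z(\ell)=\frac1{\Gamma(\alpha)}\int_a^\ell\Phi'(\rho)(\Phi(\ell)-\Phi(\rho))^{\alpha-1}\mathfrak z(\rho)\,\mathrm d\rho$; $\mathbb I_{a^+}^{0;\Phi}$ is the identity. For $0<\alpha\le1$ and $\mathfrak z\in C^1(\Delta,\mathbb R)$, the $\Phi$-Caputo derivative is ${}^c\mathbb D_{a^+}^{\alpha;\Phi}\mathfrak z=\mathbb I_{a^+}^{1-\alpha;\Phi}\bigl(\mathfrak z'/\Phi'\bigr)$ (so for $\alpha=1$ it is $\mathfrak z'/\Phi'$). For $\mathfrak z$ that is only continuous, it is understood in the standard extended sense ${}^c\mathbb D_{a^+}^{\alpha;\Phi}\mathfrak z(\ell)=\frac{1}{\Phi'(\ell)}\frac{\mathrm d}{\mathrm d\ell}\,\mathbb I_{a^+}^{1-\alpha;\Phi}\bigl(\mathfrak z-\mathfrak z(a)\bigr)(\ell)$, which agrees with the previous formula for $C^1$ functions; "${}^c\mathbb D_{a^+}^{\alpha;\Phi}\mathfrak z\in C(\Delta,\mathbb R)$" means that $\mathbb I_{a^+}^{1-\alpha;\Phi}(\mathfrak z-\mathfrak z(a))$ is continuously differentiable on $\Delta$ (one-sided at the endpoints). A solution is a function $\mathfrak z\in C(\Delta,\mathbb R)$ with ${}^c\mathbb D_{a^+}^{\mu;\Phi}\mathfrak z,\ {}^c\mathbb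 D_{a^+}^{\kappa;\Phi}\mathfrak z\in C(\Delta,\mathbb R)$ satisfying the equation on $\Delta$ (and the stated initial condition). The one-parameter Mittag-Leffler function is $\mathbb E_{p}(x)=\sum_{k=0}^\infty \frac{x^k}{\Gamma(pk+1)}$, $p>0$. *)

theory Defs
  imports "HOL-Analysis.Analysis"
begin

text \<open>
  Functions on the interval \<open>{a..b}\<close> are represented by total functions of which only the
  values on \<open>{a..b}\<close> matter. Accordingly every derivative is taken within \<open>{a..b}\<close>, hence is
  one-sided at the endpoints; it is unique because \<open>a < b\<close>.
\<close>

definition deriv_on :: "real \<Rightarrow> real \<Rightarrow> (real \<Rightarrow> real) \<Rightarrow> real \<Rightarrow> real" where
  "deriv_on a b f x = vector_derivative f (at x within {a..b})"

text \<open>The library's \<open>C1_differentiable_on\<close> demands two-sided derivatives at the endpoints.\<close>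

definition C1_on :: "real \<Rightarrow> real \<Rightarrow> (real \<Rightarrow> real) \<Rightarrow> bool" where
  "C1_on a b f \<longleftrightarrow> f differentiable_on {a..b} \<and> continuous_on {a..b} (deriv_on a b f)"

text \<open>
  The right endpoint \<open>b\<close> enters only through the derivative of \<open>\<Phi>\<close>. The convention
  \<open>0 powr s = 0\<close> affects the integrand only at the point \<open>\<rho> = l\<close>, when \<open>\<Phi>\<close> is strictly increasing.
\<close>

definition RL_integral ::
  "real \<Rightarrow> real \<Rightarrow> (real \<Rightarrow> real) \<Rightarrow> real \<Rightarrow> (real \<Rightarrow> real) \<Rightarrow> real \<Rightarrow> real" where
  "RL_integral a b \<Phi> \<alpha> z l =
     (if \<alpha> = 0 then z l
      else 1 / Gamma \<alpha> *
        (LINT \<rho>:{a..l}|lebesgue. deriv_on a b \<Phi> \<rho> * (\<Phi> l - \<Phi> \<rho>) powr (\<alpha> - 1) * z \<rho>))"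

text \<open>
  The Caputo derivative in the extended sense, meaningful for functions that are merely
  continuous. It is regarded as an element of the space of continuous functions exactly when
  \<open>caputo_continuous\<close> holds, that is, when the function differentiated in it is continuously
  differentiable.
\<close>

definition caputo ::
  "real \<Rightarrow> real \<Rightarrow> (real \<Rightarrow> real) \<Rightarrow> real \<Rightarrow> (real \<Rightarrow> real) \<Rightarrow> real \<Rightarrow> real" where
  "caputo a b \<Phi> \<alpha> z l =
     1 / deriv_on a b \<Phi> l * deriv_on a b (RL_integral a b \<Phi> (1 - \<alpha>) (\<lambda>\<rho>. z \<rho> - z a)) l"

definition caputo_continuous ::
  "real \<Rightarrow> real \<Rightarrow> (real \<Rightarrow> real) \<Rightarrow> real \<Rightarrow> (real \<Rightarrow> real) \<Rightarrow> bool" where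
  "caputo_continuous a b \<Phi> \<alpha> z \<longleftrightarrow>
     C1_on a b (RL_integral a b \<Phi> (1 - \<alpha>) (\<lambda>\<rho>. z \<rho> - z a))"

definition is_solution ::
  "real \<Rightarrow> real \<Rightarrow> (real \<Rightarrow> real) \<Rightarrow> real \<Rightarrow> real \<Rightarrow> real \<Rightarrow> (real \<Rightarrow> real \<Rightarrow> real) \<Rightarrow> real
    \<Rightarrow> (real \<Rightarrow> real) \<Rightarrow> bool" where
  "is_solution a b \<Phi> \<mu> \<kappa> \<omega> F za z \<longleftrightarrow>
     continuous_on {a..b} z \<and>
     caputo_continuous a b \<Phi> \<mu> z \<and>
     caputo_continuous a b \<Phi> \<kappa> z \<and>
     (\<forall>l\<in>{a..b}. caputo a b \<Phi> \<mu> z l + \<omega> * caputo a b \<Phi> \<kappa> z l = F l (z l)) \<and>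
     z a = za"

definition mittag_leffler :: "real \<Rightarrow> real \<Rightarrow> real" where
  "mittag_leffler p x = (\<Sum>k. x ^ k / Gamma (p * real k + 1))"

end

theory Submission
  imports Defs
begin

text \<open>
  The difference of the two equations is easy to estimate if the lower-order term
  \<open>\<omega> * caputo a b \<Phi> \<kappa>\<close> is absent: one integrates with order \<open>\<mu>\<close>, uses the Lipschitz condition and applies the
  fractional Gronwall inequality, whose extremal function is the Mittag-Leffler function. The point of the theorem
  is that the lower-order term, because \<open>\<omega> > 0\<close>, is dissipative and may be dropped.

  In the time \<open>t = \<Phi> l - \<Phi> a\<close> let \<open>u\<close> be the difference of the solutions, \<open>w\<close> that difference minus its
  initial value \<open>c\<close>, \<open>g\<close> the difference of the right-hand sides, and \<open>I\<^sup>\<alpha>\<close> the fractional integral of order \<open>\<alpha>\<close>.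
  Integrating the equation once (\<open>solution_integrated\<close>) and then with order \<open>\<mu>\<close>
  (\<open>integrated_equation_to_resolvent_form\<close>) gives, with \<open>\<beta> = \<mu> - \<kappa>\<close>,
  \<open>w + \<omega> I\<^sup>\<beta> w = I\<^sup>\<mu> g\<close>.
  From this one wants \<open>\<bar>w\<bar> \<le> I\<^sup>\<mu> \<bar>g\<bar>\<close>, which is usually read off from the positivity of a resolvent kernel.
  Here it follows from a maximum principle (\<open>two_term_comparison\<close>). Since \<open>I\<^sup>\<mu> = I\<^sup>\<beta> I\<^sup>\<kappa>\<close>
  (\<open>frac_int_semigroup\<close>), the difference \<open>I\<^sup>\<mu> \<bar>g\<bar> - w\<close> is \<open>I\<^sup>\<beta> \<psi>\<close> with \<open>\<psi> = I\<^sup>\<kappa> (\<bar>g\<bar> - g) + \<omega> w\<close>. At a negative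
  minimum of this difference \<open>w\<close>, and with it \<open>\<psi>\<close>, would be positive; but an integral \<open>I\<^sup>\<beta> \<psi>\<close> of a continuous function
  of order \<open>\<beta> < 1\<close> cannot have a nonpositive minimum over its past at a point where \<open>\<psi> > 0\<close>
  (\<open>frac_int_extremum_principle\<close>).

  That principle is the heart of the proof. The singular kernel weighs a past of \<open>\<psi>\<close> as seen from a later time \<open>t\<close> in
  the same way, up to a monotone factor, as seen from the end of that past. By the second mean value theorem
  a nonpositive lower bound for the earlier values of \<open>I\<^sup>\<beta> \<psi>\<close> (suitably normalised) bounds from below what any
  past contributes at time \<open>t\<close> (\<open>past_conv_ge\<close>), so a final positive stretch of \<open>\<psi>\<close> pushes \<open>I\<^sup>\<beta> \<psi>\<close> strictly above
  that bound.

  Finally \<open>\<bar>u\<bar> \<le> \<bar>c\<bar> + \<bar>w\<bar> \<le> \<bar>c\<bar> + L I\<^sup>\<mu> \<bar>u\<bar>\<close>, and \<open>fractional_gronwall\<close> concludes.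
\<close>

section \<open>Fractional integrals in standard time\<close>

text \<open>
  The Riemann--Liouville integral with the identity in place of \<open>\<Phi>\<close> and base point \<open>0\<close>. The time
  change \<open>t = \<Phi> l - \<Phi> a\<close> reduces every \<open>RL_integral\<close> to it. Order \<open>0\<close> is the identity, so that
  \<open>\<mu> = 1\<close> needs no separate treatment.
\<close>
definition frac_int :: "real \<Rightarrow> (real \<Rightarrow> real) \<Rightarrow> real \<Rightarrow> real" where
  "frac_int \<alpha> f t =
     (if \<alpha> = 0 then f t
      else 1 / Gamma \<alpha> * integral {0..t} (\<lambda>s. (t - s) powr (\<alpha> - 1) * f s))"

lemma Gamma_real_nonzero: "0 < (x :: real) \<Longrightarrow> Gamma x \<noteq> 0"
  by (metis Gamma_real_pos less_irrefl)

lemma kernel_absolutely_integrable: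
  fixes \<alpha> r t :: real
  assumes "0 < \<alpha>" "r \<le> t"
  shows "(\<lambda>s. (t - s) powr (\<alpha> - 1)) absolutely_integrable_on {0..r}"
proof (cases "0 \<le> r")
  case True
  have "(\<lambda>x. x powr (\<alpha> - 1)) integrable_on {0..t}"
    using has_integral_powr_from_0[of "\<alpha> - 1" t] assms True by (auto simp: integrable_on_def)
  then obtain i where "((\<lambda>x. x powr (\<alpha> - 1)) has_integral i) (cbox 0 t)"
    by (auto simp: integrable_on_def)
  from has_integral_affinity[OF this, of "-1" t]
  have "(\<lambda>s. (t - s) powr (\<alpha> - 1)) integrable_on ((\<lambda>x. -x + t) ` {0..t})"
    by (auto simp: integrable_on_def)
  also have "(\<lambda>x. -x + t) ` {0..t} = {0..t}"
    using image_diff_atLeastAtMost[of t 0 t] by (simp add: add.commute)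
  finally have "(\<lambda>s. (t - s) powr (\<alpha> - 1)) integrable_on {0..r}"
    by (rule integrable_on_subinterval) (use assms in auto)
  then show ?thesis
    by (rule nonnegative_absolutely_integrable_1) auto
qed auto

lemma kernel_times_absolutely_integrable:
  fixes \<alpha> r t :: real
  assumes "0 < \<alpha>" "r \<le> t" "continuous_on {0..r} f"
  shows "(\<lambda>s. (t - s) powr (\<alpha> - 1) * f s) absolutely_integrable_on {0..r}"
proof -
  have "(\<lambda>s. f s * (t - s) powr (\<alpha> - 1)) absolutely_integrable_on {0..r}"
  proof (rule absolutely_integrable_bounded_measurable_product_real)
    show "f \<in> borel_measurable (lebesgue_on {0..r})"
      using assms by (intro continuous_imp_measurable_on_sets_lebesgue) auto
    show "bounded (f ` {0..r})"
      using assms by (intro compact_imp_bounded compact_continuous_image) auto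
  qed (use kernel_absolutely_integrable assms in auto)
  then show ?thesis by (simp add: mult.commute)
qed

lemma kernel_times_integrable:
  fixes \<alpha> r t :: real
  assumes "0 < \<alpha>" "r \<le> t" "continuous_on {0..r} f"
  shows "(\<lambda>s. (t - s) powr (\<alpha> - 1) * f s) integrable_on {0..r}"
  using kernel_times_absolutely_integrable[OF assms] set_lebesgue_integral_eq_integral(1) by blast

lemma frac_int_cong:
  assumes "\<And>s. 0 \<le> s \<Longrightarrow> s \<le> t \<Longrightarrow> f s = g s" "0 \<le> t"
  shows "frac_int \<alpha> f t = frac_int \<alpha> g t"
proof -
  have "integral {0..t} (\<lambda>s. (t - s) powr (\<alpha> - 1) * f s)
      = integral {0..t} (\<lambda>s. (t - s) powr (\<alpha> - 1) * g s)"
    by (rule integral_cong) (use assms in auto)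
  then show ?thesis using assms by (simp add: frac_int_def)
qed

text \<open>
  The endpoints are left out because powers are compared below and \<open>0 powr 0 = 0\<close>, whereas \<open>0 ^ 0 = 1\<close>.
\<close>
lemma frac_int_spike:
  assumes "\<And>s. 0 < s \<Longrightarrow> s < t \<Longrightarrow> f s = g s" "\<alpha> \<noteq> 0"
  shows "frac_int \<alpha> f t = frac_int \<alpha> g t"
proof -
  have "integral {0..t} (\<lambda>s. (t - s) powr (\<alpha> - 1) * f s)
      = integral {0..t} (\<lambda>s. (t - s) powr (\<alpha> - 1) * g s)"
    by (rule integral_spike[of "{0,t}"]) (use assms in auto)
  then show ?thesis using assms by (simp add: frac_int_def)
qed

lemma frac_int_at_0: "0 < \<alpha> \<Longrightarrow> frac_int \<alpha> f 0 = 0"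
  by (simp add: frac_int_def)

lemma frac_int_add:
  assumes "0 \<le> \<alpha>" "continuous_on {0..t} f" "continuous_on {0..t} g"
  shows "frac_int \<alpha> (\<lambda>s. f s + g s) t = frac_int \<alpha> f t + frac_int \<alpha> g t"
proof (cases "\<alpha> = 0")
  case False
  with assms(1) have "0 < \<alpha>" by simp
  then show ?thesis
    unfolding frac_int_def distrib_left
    by (subst integral_add)
       (use assms in \<open>auto intro!: kernel_times_integrable simp: distrib_left\<close>)
qed (simp add: frac_int_def)

lemma frac_int_cmult:
  "frac_int \<alpha> (\<lambda>s. c * f s) t = c * frac_int \<alpha> f t"
proof -
  have "(\<lambda>s. (t - s) powr (\<alpha> - 1) * (c * f s)) = (\<lambda>s. c * ((t - s) powr (\<alpha> - 1) * f s))"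
    by (simp add: ac_simps)
  then show ?thesis
    unfolding frac_int_def by (simp only: integral_mult_right) simp
qed

lemma frac_int_minus:
  "frac_int \<alpha> (\<lambda>s. - f s) t = - frac_int \<alpha> f t"
  using frac_int_cmult[of \<alpha> "-1" f t] by simp

lemma frac_int_diff:
  assumes "0 \<le> \<alpha>" "continuous_on {0..t} f" "continuous_on {0..t} g"
  shows "frac_int \<alpha> (\<lambda>s. f s - g s) t = frac_int \<alpha> f t - frac_int \<alpha> g t"
  using frac_int_add[of \<alpha> t f "\<lambda>s. - g s"] assms
  by (auto simp: frac_int_minus continuous_on_minus)

lemma frac_int_sum:
  assumes "0 \<le> \<alpha>" "finite A" "\<And>i. i \<in> A \<Longrightarrow> continuous_on {0..t} (f i)"
  shows "frac_int \<alpha> (\<lambda>s. \<Sum>i\<in>A. f i s) t = (\<Sum>i\<in>A. frac_int \<alpha> (f i) t)"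
  using assms(2,3)
proof (induction A rule: finite_induct)
  case empty
  show ?case by (simp add: frac_int_def)
next
  case (insert x A)
  then have "frac_int \<alpha> (\<lambda>s. f x s + (\<Sum>i\<in>A. f i s)) t
      = frac_int \<alpha> (f x) t + frac_int \<alpha> (\<lambda>s. \<Sum>i\<in>A. f i s) t"
    using assms(1) by (intro frac_int_add continuous_on_sum) auto
  with insert show ?case by simp
qed

lemma frac_int_mono:
  assumes "0 \<le> \<alpha>" "0 \<le> t" "continuous_on {0..t} f" "continuous_on {0..t} g"
    and "\<And>s. 0 \<le> s \<Longrightarrow> s \<le> t \<Longrightarrow> f s \<le> g s"
  shows "frac_int \<alpha> f t \<le> frac_int \<alpha> g t"
proof (cases "\<alpha> = 0")
  case False
  have "integral {0..t} (\<lambda>s. (t - s) powr (\<alpha> - 1) * f s)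
      \<le> integral {0..t} (\<lambda>s. (t - s) powr (\<alpha> - 1) * g s)"
    using assms False by (intro integral_le kernel_times_integrable mult_left_mono) auto
  then show ?thesis
    using False assms(1) Gamma_real_pos[of \<alpha>] by (auto simp: frac_int_def divide_right_mono)
qed (use assms in \<open>auto simp: frac_int_def\<close>)

lemma frac_int_nonneg:
  assumes "0 \<le> \<alpha>" "0 \<le> t" "continuous_on {0..t} f" "\<And>s. 0 \<le> s \<Longrightarrow> s \<le> t \<Longrightarrow> 0 \<le> f s"
  shows "0 \<le> frac_int \<alpha> f t"
proof -
  have "frac_int \<alpha> (\<lambda>_. 0) t \<le> frac_int \<alpha> f t"
    using assms by (intro frac_int_mono) auto
  then show ?thesis by (simp add: frac_int_def split: if_splits)
qed

text \<open>
  The kernel is homogeneous, so the substitution \<open>s = c x\<close> moves the dependence on the upper limit into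
  the argument of \<open>f\<close>. This is what makes continuity in the upper limit accessible despite the singularity.
\<close>
lemma integral_kernel_stretch:
  fixes \<alpha> \<theta> t :: real
  assumes "0 < t" "0 < c"
  shows "integral {0..\<theta> * c} (\<lambda>s. (t - s) powr (\<alpha> - 1) * f s)
       = c powr \<alpha> * integral {0..\<theta>} (\<lambda>x. (t/c - x) powr (\<alpha> - 1) * f (c * x))"
proof -
  have im: "(\<lambda>x. x / c) ` {0..\<theta> * c} = {0..\<theta>}"
    using assms by (simp add: image_divide_atLeastAtMost)
  have "integral {0..\<theta> * c} (\<lambda>s. (t - s) powr (\<alpha> - 1) * f s)
      = c * integral {0..\<theta>} (\<lambda>x. (t - c * x) powr (\<alpha> - 1) * f (c * x))"
    using integral_stretch_real[of c 0 "\<theta> * c" "\<lambda>s. (t - s) powr (\<alpha> - 1) * f s"] im assms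
    by simp
  also have "(\<lambda>x. (t - c * x) powr (\<alpha> - 1) * f (c * x))
      = (\<lambda>x. c powr (\<alpha> - 1) * ((t/c - x) powr (\<alpha> - 1) * f (c * x)))"
  proof
    fix x
    have "t - c * x = c * (t/c - x)" using assms by (simp add: field_simps)
    then show "(t - c * x) powr (\<alpha> - 1) * f (c * x)
      = c powr (\<alpha> - 1) * ((t/c - x) powr (\<alpha> - 1) * f (c * x))"
      using assms by (simp add: powr_mult)
  qed
  finally have "integral {0..\<theta> * c} (\<lambda>s. (t - s) powr (\<alpha> - 1) * f s)
      = (c * c powr (\<alpha> - 1)) * integral {0..\<theta>} (\<lambda>x. (t/c - x) powr (\<alpha> - 1) * f (c * x))"
    by (simp only: integral_mult_right mult.assoc)
  also have "c * c powr (\<alpha> - 1) = c powr \<alpha>"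
    using assms by (simp add: powr_diff)
  finally show ?thesis .
qed

lemma frac_int_powr:
  fixes \<alpha> p t :: real
  assumes "0 < \<alpha>" "-1 < p" "0 \<le> t"
  shows "frac_int \<alpha> (\<lambda>s. s powr p) t = Gamma (p + 1) / Gamma (p + 1 + \<alpha>) * t powr (p + \<alpha>)"
proof (cases "t = 0")
  case False
  have B: "integral {0..1} (\<lambda>x. (1 - x) powr (\<alpha> - 1) * x powr p) = Beta (p+1) \<alpha>"
    using has_integral_Beta_real[of "p + 1" \<alpha>] assms
    by (simp add: has_integral_iff mult.commute)
  have "integral {0..1} (\<lambda>x. (1 - x) powr (\<alpha> - 1) * (t * x) powr p)
      = integral {0..1} (\<lambda>x. t powr p * ((1 - x) powr (\<alpha> - 1) * x powr p))"
    by (rule integral_cong) (use assms in \<open>auto simp: powr_mult\<close>)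
  also have "\<dots> = t powr p * Beta (p+1) \<alpha>"
    unfolding integral_mult_right B ..
  finally have "integral {0..1 * t} (\<lambda>s. (t - s) powr (\<alpha> - 1) * s powr p)
     = t powr \<alpha> * (t powr p * Beta (p+1) \<alpha>)"
    using False assms by (subst integral_kernel_stretch) auto
  moreover have "Gamma \<alpha> \<noteq> 0"
    using assms(1) by (rule Gamma_real_nonzero)
  ultimately show ?thesis
    using assms by (simp add: frac_int_def Beta_def powr_add)
qed (use assms in \<open>auto simp: frac_int_def\<close>)

lemma frac_int_scaled:
  assumes "0 < \<alpha>" "0 \<le> t"
  shows "frac_int \<alpha> f t
       = t powr \<alpha> / Gamma \<alpha> * integral {0..1} (\<lambda>x. (1 - x) powr (\<alpha> - 1) * f (t * x))"
proof (cases "t = 0")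
  case False
  then show ?thesis
    using assms integral_kernel_stretch[of t t 1 \<alpha> f] by (simp add: frac_int_def)
qed (use assms in \<open>simp add: frac_int_def\<close>)

text \<open>
  After scaling, the singularity sits at the fixed point \<open>x = 1\<close>, so one integrable majorant serves
  for all \<open>(\<theta>, t)\<close>, and dominated convergence gives joint continuity.
\<close>
lemma continuous_on_partial_scaled:
  fixes f :: "real \<Rightarrow> real"
  assumes \<alpha>: "0 < \<alpha>" and f: "continuous_on {0..T} f"
  shows "continuous_on ({0..1} \<times> {0..T})
           (\<lambda>(\<theta>, t). integral {0..\<theta>} (\<lambda>x. (1 - x) powr (\<alpha> - 1) * f (t * x)))"
proof -
  define k :: "real \<Rightarrow> real \<Rightarrow> real \<Rightarrow> real"
    where "k \<theta> t x = indicator {0..\<theta>} x *\<^sub>R ((1 - x) powr (\<alpha> - 1) * f (t * x))" for \<theta> t x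
  have maps: "t * x \<in> {0..T}" if "x \<in> {0..1}" "t \<in> {0..T}" for x t
    using that mult_left_le[of x t] by auto
  have int: "(\<lambda>x. (1 - x) powr (\<alpha> - 1) * f (t * x)) absolutely_integrable_on {0..\<theta>}"
    if "\<theta> \<in> {0..1}" "t \<in> {0..T}" for \<theta> t
  proof (rule kernel_times_absolutely_integrable)
    show "continuous_on {0..\<theta>} (\<lambda>x. f (t * x))"
      by (rule continuous_on_compose2[OF f]) (use that maps in \<open>auto intro!: continuous_intros\<close>)
  qed (use that \<alpha> in auto)
  have k_int: "integrable lebesgue (k \<theta> t)" if "\<theta> \<in> {0..1}" "t \<in> {0..T}" for \<theta> t
    using int[OF that] by (simp add: set_integrable_def k_def[abs_def])
  have k_eq: "integral {0..\<theta>} (\<lambda>x. (1 - x) powr (\<alpha> - 1) * f (t * x)) = (LINT x|lebesgue. k \<theta> t x)"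
    if "\<theta> \<in> {0..1}" "t \<in> {0..T}" for \<theta> t
    using set_lebesgue_integral_eq_integral(2)[OF int[OF that]]
    by (simp add: set_lebesgue_integral_def k_def)
  obtain M where M: "\<And>s. s \<in> {0..T} \<Longrightarrow> \<bar>f s\<bar> \<le> M"
    using compact_imp_bounded[OF compact_continuous_image[OF f compact_Icc]]
    unfolding bounded_iff by (metis image_eqI real_norm_def)
  have "continuous_on ({0..1} \<times> {0..T}) (\<lambda>p. LINT x|lebesgue. k (fst p) (snd p) x)"
    unfolding continuous_on_sequentially
  proof safe
    fix q :: "nat \<Rightarrow> real \<times> real" and \<theta> t :: real
    assume q: "\<forall>n. q n \<in> {0..1} \<times> {0..T}" and lim: "q \<longlonglongrightarrow> (\<theta>, t)"
      and mem: "\<theta> \<in> {0..1}" "t \<in> {0..T}"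
    have q': "fst (q n) \<in> {0..1}" "snd (q n) \<in> {0..T}" for n
      using q by (auto simp: mem_Times_iff)
    have lim\<theta>: "(\<lambda>n. fst (q n)) \<longlonglongrightarrow> \<theta>" and limt: "(\<lambda>n. snd (q n)) \<longlonglongrightarrow> t"
      using tendsto_fst[OF lim] tendsto_snd[OF lim] by simp_all
    have "(\<lambda>n. LINT x|lebesgue. k (fst (q n)) (snd (q n)) x) \<longlonglongrightarrow> (LINT x|lebesgue. k \<theta> t x)"
    proof (rule integral_dominated_convergence)
      show "k \<theta> t \<in> borel_measurable lebesgue"
        using k_int[OF mem] by (rule borel_measurable_integrable)
      show "k (fst (q n)) (snd (q n)) \<in> borel_measurable lebesgue" for n
        using k_int[OF q'] by (rule borel_measurable_integrable)
      show "integrable lebesgue (\<lambda>x. M * (indicator {0..1} x *\<^sub>R (1 - x) powr (\<alpha> - 1)))"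
        using kernel_absolutely_integrable[of \<alpha> 1 1] \<alpha>
        by (intro integrable_mult_right) (simp add: set_integrable_def)
      show "AE x in lebesgue. norm (k (fst (q n)) (snd (q n)) x)
              \<le> M * (indicator {0..1} x *\<^sub>R (1 - x) powr (\<alpha> - 1))" for n
      proof (rule AE_I2)
        fix x :: real
        show "norm (k (fst (q n)) (snd (q n)) x)
              \<le> M * (indicator {0..1} x *\<^sub>R (1 - x) powr (\<alpha> - 1))"
        proof (cases "x \<in> {0..fst (q n)}")
          case True
          then have x: "x \<in> {0..1}" using q'(1)[of n] by auto
          have "(1 - x) powr (\<alpha> - 1) * \<bar>f (snd (q n) * x)\<bar> \<le> (1 - x) powr (\<alpha> - 1) * M"
            by (intro mult_left_mono M maps x q') auto
          then show ?thesis
            using True x by (simp add: k_def abs_mult mult.commute)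
        next
          case False
          have "0 \<le> M" using M[OF mem(2)] by auto
          with False show ?thesis
            by (auto simp: k_def)
        qed
      qed
      have "AE x in lebesgue. x \<noteq> \<theta>"
        by (rule AE_completion) (rule AE_lborel_singleton)
      then show "AE x in lebesgue. (\<lambda>n. k (fst (q n)) (snd (q n)) x) \<longlonglongrightarrow> k \<theta> t x"
      proof eventually_elim
        case (elim x)
        have ind: "(\<lambda>n. indicator {0..fst (q n)} x :: real) \<longlonglongrightarrow> indicator {0..\<theta>} x"
        proof (rule tendsto_eventually)
          show "\<forall>\<^sub>F n in sequentially. (indicator {0..fst (q n)} x :: real) = indicator {0..\<theta>} x"
          proof (cases "x < \<theta>")
            case True
            from order_tendstoD(1)[OF lim\<theta> True] show ?thesis
              by eventually_elim (use True in \<open>auto simp: indicator_def\<close>)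
          next
            case False
            with elim have "\<theta> < x" by simp
            from order_tendstoD(2)[OF lim\<theta> this] show ?thesis
              by eventually_elim (use \<open>\<theta> < x\<close> in \<open>auto simp: indicator_def\<close>)
          qed
        qed
        show ?case
        proof (cases "x \<in> {0..1}")
          case True
          have "(\<lambda>n. f (snd (q n) * x)) \<longlonglongrightarrow> f (t * x)"
            by (rule continuous_on_tendsto_compose[OF f])
               (use True mem q' maps in \<open>auto intro!: tendsto_intros limt simp del: atLeastAtMost_iff\<close>)
          then show ?thesis
            unfolding k_def by (intro tendsto_intros ind)
        next
          case False
          then have "k \<theta>' t' x = 0" if "\<theta>' \<in> {0..1}" for \<theta>' t'
            using that by (auto simp: k_def indicator_def)
          then show ?thesis using q' mem by simp
        qed
      qed
    qed
    then show "((\<lambda>p. LINT x|lebesgue. k (fst p) (snd p) x) \<circ> q) \<longlonglongrightarrow>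
        (LINT x|lebesgue. k (fst (\<theta>, t)) (snd (\<theta>, t)) x)"
      by (simp add: o_def)
  qed
  then show ?thesis
    by (rule continuous_on_eq) (use k_eq in auto)
qed

lemma continuous_on_frac_int:
  assumes "0 \<le> \<alpha>" "continuous_on {0..T} f"
  shows "continuous_on {0..T} (frac_int \<alpha> f)"
proof (cases "\<alpha> = 0")
  case True
  then have "frac_int \<alpha> f = f" by (simp add: frac_int_def fun_eq_iff)
  with assms show ?thesis by simp
next
  case False
  with assms have \<alpha>: "0 < \<alpha>" by simp
  have "continuous_on {0..T}
      ((\<lambda>(\<theta>, t). integral {0..\<theta>} (\<lambda>x. (1 - x) powr (\<alpha> - 1) * f (t * x))) \<circ> (\<lambda>t. (1, t)))"
    by (intro continuous_on_compose continuous_intros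
        continuous_on_subset[OF continuous_on_partial_scaled[OF \<alpha> assms(2)]]) auto
  then have "continuous_on {0..T} (\<lambda>t. integral {0..1} (\<lambda>x. (1 - x) powr (\<alpha> - 1) * f (t * x)))"
    by (simp add: o_def)
  moreover have "continuous_on {0..T} (\<lambda>t. t powr \<alpha>)"
    using \<alpha> by (intro continuous_on_powr' continuous_intros) auto
  ultimately have "continuous_on {0..T}
      (\<lambda>t. t powr \<alpha> / Gamma \<alpha> * integral {0..1} (\<lambda>x. (1 - x) powr (\<alpha> - 1) * f (t * x)))"
    using Gamma_real_nonzero[OF \<alpha>]
    by (intro continuous_on_mult continuous_on_divide continuous_on_const) auto
  then show ?thesis
    by (rule continuous_on_eq) (simp add: frac_int_scaled[OF \<alpha>])
qed

section \<open>The semigroup property\<close>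

lemma frac_int_abs_le:
  assumes "0 \<le> \<alpha>" "0 \<le> t" "continuous_on {0..t} f" "continuous_on {0..t} g"
    and "\<And>s. 0 \<le> s \<Longrightarrow> s \<le> t \<Longrightarrow> \<bar>f s\<bar> \<le> g s"
  shows "\<bar>frac_int \<alpha> f t\<bar> \<le> frac_int \<alpha> g t"
proof (rule abs_leI)
  show "frac_int \<alpha> f t \<le> frac_int \<alpha> g t"
    using assms by (intro frac_int_mono) (auto simp: abs_le_iff)
  have "frac_int \<alpha> (\<lambda>s. - f s) t \<le> frac_int \<alpha> g t"
    using assms by (intro frac_int_mono continuous_intros) (auto simp: abs_le_iff)
  then show "- frac_int \<alpha> f t \<le> frac_int \<alpha> g t" by (simp add: frac_int_minus)
qed

lemma frac_int_monomial:
  assumes "0 < \<alpha>" "0 \<le> t"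
  shows "frac_int \<alpha> (\<lambda>s. s ^ n) t
       = Gamma (real n + 1) / Gamma (real n + 1 + \<alpha>) * t powr (real n + \<alpha>)"
proof -
  have "frac_int \<alpha> (\<lambda>s. s ^ n) t = frac_int \<alpha> (\<lambda>s. s powr real n) t"
    by (rule frac_int_spike) (use assms in \<open>auto simp: powr_realpow\<close>)
  then show ?thesis using assms by (simp add: frac_int_powr)
qed

lemma frac_int_semigroup_monomial:
  assumes "0 < \<alpha>" "0 < \<beta>" "0 \<le> t"
  shows "frac_int \<alpha> (frac_int \<beta> (\<lambda>s. s ^ n)) t = frac_int (\<alpha> + \<beta>) (\<lambda>s. s ^ n) t"
proof -
  have \<Gamma>: "Gamma (real n + 1 + \<beta>) \<noteq> 0"
    using assms by (intro Gamma_real_nonzero) simp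
  have "frac_int \<alpha> (frac_int \<beta> (\<lambda>s. s ^ n)) t
      = frac_int \<alpha> (\<lambda>s. Gamma (real n + 1) / Gamma (real n + 1 + \<beta>) * s powr (real n + \<beta>)) t"
    by (rule frac_int_cong) (use assms in \<open>auto simp: frac_int_monomial\<close>)
  also have "\<dots> = Gamma (real n + 1) / Gamma (real n + 1 + \<beta>)
      * (Gamma (real n + \<beta> + 1) / Gamma (real n + \<beta> + 1 + \<alpha>) * t powr (real n + \<beta> + \<alpha>))"
    unfolding frac_int_cmult using assms by (simp add: frac_int_powr)
  also have "\<dots> = frac_int (\<alpha> + \<beta>) (\<lambda>s. s ^ n) t"
    using assms \<Gamma> by (simp add: frac_int_monomial ac_simps)
  finally show ?thesis .
qed

text \<open>
  Both sides are linear in \<open>f\<close> and bounded by a multiple of the supremum of \<open>\<bar>f\<bar>\<close>, and they agree on monomials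
  by the Beta integral. Polynomials are dense among the continuous functions, so both sides agree everywhere.
  This avoids interchanging the order of integration under two singular kernels.
\<close>
lemma frac_int_semigroup:
  assumes \<alpha>: "0 < \<alpha>" and \<beta>: "0 \<le> \<beta>" and f: "continuous_on {0..T} f" and t: "t \<in> {0..T}"
  shows "frac_int \<alpha> (frac_int \<beta> f) t = frac_int (\<alpha> + \<beta>) f t"
proof (cases "\<beta> = 0")
  case True
  then have "frac_int \<beta> f = f" by (simp add: frac_int_def fun_eq_iff)
  with True show ?thesis by simp
next
  case False
  with \<beta> have \<beta>: "0 < \<beta>" by simp
  define one :: "real \<Rightarrow> real" where "one = (\<lambda>_. 1)"
  define c where "c = frac_int \<alpha> (frac_int \<beta> one) t + frac_int (\<alpha> + \<beta>) one t"
  have cont1: "continuous_on S one" for S unfolding one_def by simp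
  have sub: "continuous_on {0..s} h" if "continuous_on {0..t} h" "s \<le> t" for h :: "real \<Rightarrow> real" and s
    using that by (auto intro: continuous_on_subset)
  have II: "continuous_on {0..t} (frac_int \<beta> h)" if "continuous_on {0..t} h" for h
    using that \<beta> by (intro continuous_on_frac_int) auto
  have ft: "continuous_on {0..t} f" using f t by (auto intro: continuous_on_subset)
  have c: "0 \<le> c"
    unfolding c_def using \<alpha> \<beta> t
    by (intro add_nonneg_nonneg frac_int_nonneg II cont1) (auto simp: one_def)
  have small: "\<bar>frac_int \<alpha> (frac_int \<beta> f) t - frac_int (\<alpha> + \<beta>) f t\<bar> \<le> e * c" if e: "0 < e" for e
  proof -
    obtain g where g: "real_polynomial_function g" "\<And>x. x \<in> {0..t} \<Longrightarrow> \<bar>f x - g x\<bar> < e"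
      using Stone_Weierstrass_real_polynomial_function[OF compact_Icc ft e] by blast
    obtain a n where g_eq: "g = (\<lambda>x. \<Sum>i\<le>n. a i * x ^ i)"
      using g(1) by (auto simp: real_polynomial_function_iff_sum)
    have gt: "continuous_on {0..t} g" unfolding g_eq by (intro continuous_intros)
    have g_int: "frac_int \<gamma> g s = (\<Sum>i\<le>n. a i * frac_int \<gamma> (\<lambda>x. x ^ i) s)" if "0 < \<gamma>" for \<gamma> s
      unfolding g_eq using that
      by (subst frac_int_sum) (auto simp: frac_int_cmult intro!: continuous_intros)
    have semi_g: "frac_int \<alpha> (frac_int \<beta> g) t = frac_int (\<alpha> + \<beta>) g t"
    proof -
      have "frac_int \<alpha> (frac_int \<beta> g) t
          = frac_int \<alpha> (\<lambda>s. \<Sum>i\<le>n. a i * frac_int \<beta> (\<lambda>x. x ^ i) s) t"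
        by (rule frac_int_cong) (use g_int \<beta> t in auto)
      also have "\<dots> = (\<Sum>i\<le>n. a i * frac_int \<alpha> (frac_int \<beta> (\<lambda>x. x ^ i)) t)"
        using \<alpha> by (subst frac_int_sum)
          (auto simp: frac_int_cmult intro!: continuous_intros II)
      also have "\<dots> = frac_int (\<alpha> + \<beta>) g t"
        using \<alpha> \<beta> t by (simp add: g_int frac_int_semigroup_monomial)
      finally show ?thesis .
    qed
    define h where "h s = f s - g s" for s
    have ht: "continuous_on {0..t} h" unfolding h_def by (intro continuous_intros ft gt)
    have hb: "\<bar>h s\<bar> \<le> e * one s" if "0 \<le> s" "s \<le> t" for s
      using g(2)[of s] that by (simp add: h_def one_def)
    have diff: "frac_int \<gamma> h s = frac_int \<gamma> f s - frac_int \<gamma> g s" if "0 \<le> \<gamma>" "s \<le> t" for \<gamma> s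
      unfolding h_def by (rule frac_int_diff) (use that sub ft gt in auto)
    have "frac_int \<alpha> (frac_int \<beta> h) t = frac_int \<alpha> (\<lambda>s. frac_int \<beta> f s - frac_int \<beta> g s) t"
      by (rule frac_int_cong) (use diff \<beta> t in auto)
    also have "\<dots> = frac_int \<alpha> (frac_int \<beta> f) t - frac_int \<alpha> (frac_int \<beta> g) t"
      using \<alpha> by (intro frac_int_diff II ft gt) auto
    finally have IIh: "frac_int \<alpha> (frac_int \<beta> h) t
        = frac_int \<alpha> (frac_int \<beta> f) t - frac_int \<alpha> (frac_int \<beta> g) t" .
    have bound: "\<bar>frac_int \<gamma> h s\<bar> \<le> e * frac_int \<gamma> one s" if "0 \<le> \<gamma>" "0 \<le> s" "s \<le> t" for \<gamma> s
    proof -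
      have "\<bar>frac_int \<gamma> h s\<bar> \<le> frac_int \<gamma> (\<lambda>s. e * one s) s"
        by (rule frac_int_abs_le) (use that sub ht hb cont1 in \<open>auto intro!: continuous_intros\<close>)
      then show ?thesis by (simp add: frac_int_cmult)
    qed
    have "\<bar>frac_int \<alpha> (frac_int \<beta> h) t\<bar> \<le> frac_int \<alpha> (\<lambda>s. e * frac_int \<beta> one s) t"
      by (rule frac_int_abs_le) (use \<alpha> \<beta> t bound II ht cont1 in \<open>auto intro!: continuous_intros\<close>)
    then have "\<bar>frac_int \<alpha> (frac_int \<beta> h) t\<bar> \<le> e * frac_int \<alpha> (frac_int \<beta> one) t"
      by (simp add: frac_int_cmult)
    moreover have "\<bar>frac_int (\<alpha> + \<beta>) h t\<bar> \<le> e * frac_int (\<alpha> + \<beta>) one t"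
      using \<alpha> \<beta> t by (intro bound) auto
    ultimately show ?thesis
      using semi_g diff[of "\<alpha> + \<beta>" t] IIh \<alpha> \<beta> unfolding c_def by (simp add: distrib_left)
  qed
  have "\<bar>frac_int \<alpha> (frac_int \<beta> f) t - frac_int (\<alpha> + \<beta>) f t\<bar> \<le> 0 + e" if "0 < e" for e
  proof -
    have "e / (c + 1) * c \<le> e" using c that by (simp add: field_simps)
    with small[of "e / (c + 1)"] c that show ?thesis by auto
  qed
  then have "\<bar>frac_int \<alpha> (frac_int \<beta> f) t - frac_int (\<alpha> + \<beta>) f t\<bar> \<le> 0"
    by (rule field_le_epsilon)
  then show ?thesis by simp
qed

text \<open>
  An integral of order one can be cancelled: this undoes the integration performed on the equation.
\<close>
lemma frac_int_1_eq_0_imp: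
  assumes "0 < T" "continuous_on {0..T} f"
    and zero: "\<And>t. t \<in> {0..T} \<Longrightarrow> frac_int 1 f t = 0" and t: "t \<in> {0..T}"
  shows "f t = 0"
proof -
  have int: "integral {0..s} f = 0" if "s \<in> {0..T}" for s
  proof -
    have "integral {0..s} f = integral {0..s} (\<lambda>r. (s - r) powr (1 - 1) * f r)"
      by (rule integral_spike[of "{s}"]) auto
    with zero[OF that] show ?thesis by (simp add: frac_int_def)
  qed
  have deriv: "((\<lambda>u. integral {0..u} f) has_vector_derivative f t) (at t within {0..T})"
    by (rule integral_has_vector_derivative[OF assms(2) t])
  have "((\<lambda>u. 0) has_vector_derivative f t) (at t within {0..T})"
    by (rule has_vector_derivative_transform[OF t _ deriv]) (simp add: int)
  moreover have "((\<lambda>u. 0) has_vector_derivative 0) (at t within {0..T})"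
    by (rule has_vector_derivative_const)
  moreover have "at t within {0..T} \<noteq> bot"
    using assms(1) t by (simp add: trivial_limit_within islimpt_Icc)
  ultimately show ?thesis
    using vector_derivative_unique_within by blast
qed

section \<open>An extremum principle for integrals of order below one\<close>

text \<open>
  Up to the substitution \<open>s = t x\<close>, this is \<open>t powr (1 - \<beta>)\<close> times the integral of \<open>(t - s) powr (\<beta> - 1) * f s\<close>
  over the past \<open>{0..\<theta> * t}\<close>: the contribution to the fractional integral at time \<open>t\<close> of what \<open>f\<close> did
  before time \<open>\<theta> * t\<close>. The normalisation by the kernel at \<open>s = 0\<close> is the one that
  makes the next lemma an equality without a factor. The parametrisation by \<open>\<theta>\<close> puts the domain into a compact
  rectangle on which the function is continuous.
\<close>
definition past_conv :: "real \<Rightarrow> (real \<Rightarrow> real) \<Rightarrow> real \<Rightarrow> real \<Rightarrow> real" where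
  "past_conv \<beta> f \<theta> t = t * integral {0..\<theta>} (\<lambda>x. (1 - x) powr (\<beta> - 1) * f (t * x))"

text \<open>
  For \<open>\<xi> = \<theta> t < t\<close> the quotient of kernels \<open>((t - s) / (\<xi> - s)) powr (\<beta> - 1)\<close> decreases to \<open>0\<close> on \<open>{0..\<xi>}\<close>
  because \<open>\<beta> < 1\<close>. By the second mean value theorem, viewing the past \<open>{0..\<xi>}\<close> from time \<open>t\<close> is therefore,
  up to the factor at \<open>s = 0\<close>, the same as viewing some shorter past from the earlier time \<open>\<xi>\<close>.
\<close>
lemma past_conv_reproduces:
  fixes f :: "real \<Rightarrow> real"
  assumes \<beta>: "0 < \<beta>" "\<beta> < 1" and f: "continuous_on {0..T} f"
    and \<theta>: "0 < \<theta>" "\<theta> < 1" and t: "0 < t" "t \<le> T"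
  obtains \<eta> where "0 \<le> \<eta>" "\<eta> \<le> 1" "past_conv \<beta> f \<theta> t = past_conv \<beta> f \<eta> (\<theta> * t)"
proof -
  define h where "h x = (\<theta> - x) powr (\<beta> - 1) * f (t * x)" for x
  \<comment> \<open>The quotient of kernels with a minus sign, since the mean value theorem wants an increasing weight.\<close>
  define g where "g x = - (((\<theta> - x) / (1 - x)) powr (1 - \<beta>))" for x :: real
  have maps: "t * x \<in> {0..T}" if "x \<in> {0..1}" for x
    using that t by (auto intro: order.trans[OF mult_left_le])
  have h_int: "h integrable_on {0..\<theta>}"
    unfolding h_def
    by (intro kernel_times_integrable continuous_on_compose2[OF f] continuous_intros)
       (use \<beta> \<theta> maps in auto)
  have g_mono: "g x \<le> g y" if "0 \<le> x" "x \<le> y" "y \<le> \<theta>" for x y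
  proof -
    have "(\<theta> - y) / (1 - y) \<le> (\<theta> - x) / (1 - x)"
    proof -
      have "(1 - \<theta>) * x \<le> (1 - \<theta>) * y" using that \<theta> by (intro mult_left_mono) auto
      then have "(\<theta> - y) * (1 - x) \<le> (\<theta> - x) * (1 - y)" by (simp add: algebra_simps)
      then show ?thesis using that \<theta> by (simp add: divide_simps)
    qed
    then show ?thesis
      using that \<theta> \<beta> by (auto simp: g_def intro!: powr_mono2)
  qed
  obtain c where c: "c \<in> {0..\<theta>}"
    and eq: "integral {0..\<theta>} (\<lambda>x. g x * h x)
              = g 0 * integral {0..c} h + g \<theta> * integral {c..\<theta>} h"
    using second_mean_value_theorem[where g = g, OF h_int _ g_mono] \<theta> by auto
  have "integral {0..\<theta>} (\<lambda>x. (1 - x) powr (\<beta> - 1) * f (t * x))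
      = integral {0..\<theta>} (\<lambda>x. - (g x * h x))"
  \<comment> \<open>At \<open>x = \<theta>\<close> the factorisation fails, because \<open>0 powr (\<beta> - 1) = 0\<close>.\<close>
  proof (rule integral_spike[of "{\<theta>}"])
    fix x assume x: "x \<in> {0..\<theta>} - {\<theta>}"
    have "(1 - x) powr (\<beta> - 1) = 1 / (1 - x) powr (1 - \<beta>)"
      using powr_minus_divide[of "1 - x" "1 - \<beta>"] by simp
    moreover have "(\<theta> - x) powr (1 - \<beta>) * (\<theta> - x) powr (\<beta> - 1) = 1"
      using x by (simp add: powr_add[symmetric])
    ultimately have "((\<theta> - x) / (1 - x)) powr (1 - \<beta>) * (\<theta> - x) powr (\<beta> - 1)
        = (1 - x) powr (\<beta> - 1)"
      using x \<theta> by (simp add: powr_divide)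
    then show "- (g x * h x) = (1 - x) powr (\<beta> - 1) * f (t * x)"
      using x by (simp add: g_def h_def)
  qed auto
  also have "\<dots> = \<theta> powr (1 - \<beta>) * integral {0..c} h"
    using eq \<beta> by (simp add: g_def)
  also have "integral {0..c} h = \<theta> powr \<beta> *
      integral {0..c/\<theta>} (\<lambda>x. (1 - x) powr (\<beta> - 1) * f (\<theta> * t * x))"
    using integral_kernel_stretch[of \<theta> \<theta> "c/\<theta>" \<beta> "\<lambda>x. f (t * x)"] \<theta>
    by (simp add: h_def[abs_def] ac_simps)
  finally have "past_conv \<beta> f \<theta> t = (\<theta> powr (1 - \<beta>) * \<theta> powr \<beta>) * (t *
      integral {0..c/\<theta>} (\<lambda>x. (1 - x) powr (\<beta> - 1) * f (\<theta> * t * x)))"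
    by (simp add: past_conv_def)
  also have "\<theta> powr (1 - \<beta>) * \<theta> powr \<beta> = \<theta>"
    using \<theta> by (simp add: powr_add[symmetric])
  finally have "past_conv \<beta> f \<theta> t = past_conv \<beta> f (c/\<theta>) (\<theta> * t)" by (simp add: past_conv_def)
  then show thesis using that[of "c/\<theta>"] c \<theta> by auto
qed

text \<open>
  On the edge \<open>\<theta> = 1\<close> the function is the normalised fractional integral, and it vanishes where \<open>\<theta> * t = 0\<close>.
  A minimum over the rectangle below \<open>- C\<close> is impossible: among all minimisers take one for which \<open>\<theta> * t\<close> is smallest.
  The preceding lemma transports it to a minimiser \<open>(\<eta>, \<theta> * t)\<close>, whose product \<open>\<eta> * (\<theta> * t)\<close> is smaller still
  unless \<open>\<eta> = 1\<close>, that is, unless the minimum is attained on the edge.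
\<close>
lemma past_conv_ge:
  fixes f :: "real \<Rightarrow> real"
  assumes \<beta>: "0 < \<beta>" "\<beta> < 1" and f: "continuous_on {0..T} f" and "0 \<le> C"
    and diag: "\<And>t. t \<in> {0..T} \<Longrightarrow> - C \<le> past_conv \<beta> f 1 t"
    and \<theta>t: "\<theta> \<in> {0..1}" "t \<in> {0..T}"
  shows "- C \<le> past_conv \<beta> f \<theta> t"
proof (rule ccontr)
  assume "\<not> - C \<le> past_conv \<beta> f \<theta> t"
  define D where "D = {0..1::real} \<times> {0..T}"
  define p where "p = (\<lambda>q. past_conv \<beta> f (fst q) (snd q))"
  have p_cont: "continuous_on D p"
  proof -
    have "continuous_on D (\<lambda>q. snd q * (\<lambda>(\<theta>, t). integral {0..\<theta>}
        (\<lambda>x. (1 - x) powr (\<beta> - 1) * f (t * x))) q)"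
      unfolding D_def by (intro continuous_intros continuous_on_partial_scaled \<beta> f)
    then show ?thesis by (simp add: p_def past_conv_def case_prod_beta)
  qed
  have D: "compact D" "D \<noteq> {}"
    using \<theta>t by (auto simp: D_def intro: compact_Times)
  obtain q0 where q0: "q0 \<in> D" "\<And>q. q \<in> D \<Longrightarrow> p q0 \<le> p q"
    using continuous_attains_inf[OF D p_cont] by auto
  have neg: "p q0 < - C"
    using q0(2)[of "(\<theta>, t)"] \<theta>t \<open>\<not> - C \<le> past_conv \<beta> f \<theta> t\<close> by (auto simp: D_def p_def)
  define S where "S = D \<inter> p -` {p q0}"
  have "closed S"
    unfolding S_def by (intro continuous_closed_preimage p_cont compact_imp_closed D) auto
  then have "compact (D \<inter> S)" by (rule compact_Int_closed[OF D(1)])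
  then have "compact S" by (simp add: S_def Int_ac)
  moreover have "S \<noteq> {}" using q0 by (auto simp: S_def)
  moreover have "continuous_on S (\<lambda>q. fst q * snd q)" by (intro continuous_intros)
  ultimately obtain q where q: "q \<in> S"
    and q_min: "\<And>q'. q' \<in> S \<Longrightarrow> fst q * snd q \<le> fst q' * snd q'"
    using continuous_attains_inf[of S "\<lambda>q. fst q * snd q"] by auto
  obtain \<theta>' t' where [simp]: "q = (\<theta>', t')" by force
  have mem: "\<theta>' \<in> {0..1}" "t' \<in> {0..T}" and val: "past_conv \<beta> f \<theta>' t' = p q0"
    using q by (auto simp: S_def D_def p_def)
  have "\<theta>' \<noteq> 0" "t' \<noteq> 0" "\<theta>' \<noteq> 1"
    using val neg \<open>0 \<le> C\<close> diag[OF mem(2)] by (auto simp: past_conv_def)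
  with mem have "0 < \<theta>'" "\<theta>' < 1" "0 < t'" "t' \<le> T" by auto
  then obtain \<eta> where \<eta>: "0 \<le> \<eta>" "\<eta> \<le> 1"
    and rep: "past_conv \<beta> f \<theta>' t' = past_conv \<beta> f \<eta> (\<theta>' * t')"
    by (rule past_conv_reproduces[OF \<beta> f])
  have "\<theta>' * t' \<le> t'" using mem by (simp add: mult_left_le_one_le)
  then have mem': "\<theta>' * t' \<in> {0..T}" using mem by auto
  with \<eta> rep val have "(\<eta>, \<theta>' * t') \<in> S" by (auto simp: S_def D_def p_def)
  from q_min[OF this] have "1 * (\<theta>' * t') \<le> \<eta> * (\<theta>' * t')" by simp
  with \<open>0 < \<theta>'\<close> \<open>0 < t'\<close> have "1 \<le> \<eta>" by (subst (asm) mult_le_cancel_right) auto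
  with \<eta> rep val diag[OF mem'] neg show False by simp
qed

text \<open>
  If \<open>f T > 0\<close>, then \<open>f\<close> is positive on a last stretch, which contributes a positive amount to the integral at \<open>T\<close>.
  The contribution of the past before that stretch is bounded below by the preceding lemma, so the value at \<open>T\<close>
  would exceed the lower bound. No differentiability of the fractional integral enters, which is what permits
  solutions that are merely continuous.
\<close>
lemma frac_int_extremum_principle:
  assumes \<beta>: "0 < \<beta>" "\<beta> < 1" and T: "0 < T" and f: "continuous_on {0..T} f" and m: "0 \<le> m"
    and lower: "\<And>t. t \<in> {0..T} \<Longrightarrow> - m \<le> frac_int \<beta> f t"
    and attained: "frac_int \<beta> f T = - m"
  shows "f T \<le> 0"
proof (rule ccontr)
  assume "\<not> f T \<le> 0"
  then have pos: "0 < f T" by simp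
  define k where "k t x = (1 - x) powr (\<beta> - 1) * f (t * x)" for t x
  define C where "C = Gamma \<beta> * T powr (1 - \<beta>) * m"
  have \<Gamma>: "0 < Gamma \<beta>" using \<beta> Gamma_real_pos by simp
  have C: "0 \<le> C" using m \<Gamma> by (simp add: C_def)
  have P: "past_conv \<beta> f \<theta> t = t * integral {0..\<theta>} (k t)" for \<theta> t
    by (simp add: past_conv_def k_def[abs_def])
  have diag: "t * integral {0..1} (k t) = Gamma \<beta> * t powr (1 - \<beta>) * frac_int \<beta> f t"
    if "t \<in> {0..T}" for t
  proof -
    have "t = t powr (1 - \<beta>) * t powr \<beta>"
      using that by (cases "t = 0") (simp_all add: powr_add[symmetric])
    then have "t * integral {0..1} (k t) = t powr (1 - \<beta>) * t powr \<beta> * integral {0..1} (k t)"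
      by simp
    moreover have "Gamma \<beta> \<noteq> 0" using \<Gamma> by simp
    ultimately show ?thesis
      using that \<beta> by (simp add: frac_int_scaled k_def[abs_def])
  qed
  obtain d where d: "0 < d" "\<And>s. s \<in> {0..T} \<Longrightarrow> dist s T < d \<Longrightarrow> dist (f s) (f T) < f T / 2"
  proof -
    have "T \<in> {0..T}" "0 < f T / 2" using T pos by auto
    with f show thesis unfolding continuous_on_iff using that by blast
  qed
  define \<theta> where "\<theta> = max 0 (1 - d / (2 * T))"
  have \<theta>: "0 \<le> \<theta>" "\<theta> < 1" using d T by (auto simp: \<theta>_def)
  have near: "f T / 2 \<le> f (T * x)" if "x \<in> {\<theta>..1}" for x
  proof -
    have "1 - d / (2 * T) \<le> x" "0 \<le> x" using that by (auto simp: \<theta>_def)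
    then have "T - T * x \<le> d / 2" using T by (simp add: field_simps)
    moreover have "T * x \<le> T" "0 \<le> T * x" using that T \<open>0 \<le> x\<close> by (auto simp: mult_left_le)
    ultimately have "dist (f (T * x)) (f T) < f T / 2"
      using d by (intro d) (auto simp: dist_real_def)
    then show ?thesis by (auto simp: dist_real_def abs_if split: if_splits)
  qed
  have k_int: "k T integrable_on {0..1}"
    unfolding k_def
    by (intro kernel_times_integrable continuous_on_compose2[OF f] continuous_intros)
       (use \<beta> T in \<open>auto simp: mult_left_le\<close>)
  then have k_int': "k T integrable_on {\<theta>..1}"
    by (rule integrable_on_subinterval) (use \<theta> in auto)
  have "0 < (1 - \<theta>) * (f T / 2)" using \<theta> pos by simp
  also have "\<dots> = integral {\<theta>..1} (\<lambda>x. f T / 2)" using \<theta> by simp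
  also have "\<dots> = integral {\<theta>..1} (\<lambda>x. if x = 1 then 0 else f T / 2)"
    by (rule integral_spike[of "{1}"]) auto
  also have "\<dots> \<le> integral {\<theta>..1} (k T)"
  proof (rule integral_le[OF _ k_int'])
    show "(\<lambda>x. if x = 1 then 0 else f T / 2) integrable_on {\<theta>..1}"
      by (rule integrable_spike[of "\<lambda>_. f T / 2" _ "{1}"]) auto
    fix x assume x: "x \<in> {\<theta>..1}"
    show "(if x = 1 then 0 else f T / 2) \<le> k T x"
    proof (cases "x = 1")
      case False
      have "1 * (f T / 2) \<le> (1 - x) powr (\<beta> - 1) * f (T * x)"
      proof (rule mult_mono)
        have "1 powr (\<beta> - 1) \<le> (1 - x) powr (\<beta> - 1)"
          by (rule powr_mono2') (use x False \<theta> \<beta> in auto)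
        then show "1 \<le> (1 - x) powr (\<beta> - 1)" by simp
      qed (use near[OF x] pos in auto)
      with False show ?thesis by (simp add: k_def)
    qed (simp add: k_def)
  qed
  finally have "0 < T * integral {\<theta>..1} (k T)" using T by simp
  moreover have "integral {0..1} (k T) = integral {0..\<theta>} (k T) + integral {\<theta>..1} (k T)"
    using Henstock_Kurzweil_Integration.integral_combine[OF _ _ k_int, of \<theta>] \<theta> by simp
  moreover have "- C \<le> T * integral {0..\<theta>} (k T)"
  proof -
    have "- C \<le> t * integral {0..1} (k t)" if t: "t \<in> {0..T}" for t
    proof -
      have "- C \<le> (Gamma \<beta> * t powr (1 - \<beta>)) * (- m)"
        using t \<beta> m \<Gamma> by (auto simp: C_def intro!: mult_right_mono powr_mono2)
      also have "\<dots> \<le> (Gamma \<beta> * t powr (1 - \<beta>)) * frac_int \<beta> f t"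
        using lower[OF t] \<Gamma> by (intro mult_left_mono) auto
      finally show ?thesis by (simp add: diag[OF t])
    qed
    then show ?thesis
      using past_conv_ge[OF \<beta> f, of C \<theta> T] C T \<theta> by (auto simp: P)
  qed
  moreover have "T * integral {0..1} (k T) = - C"
    using diag[of T] T attained by (simp add: C_def)
  ultimately show False by (simp add: distrib_left)
qed

section \<open>Discarding the lower-order term\<close>

text \<open>
  Let \<open>G\<close> be the right-hand side of the claim. The difference \<open>G - w\<close> is the integral of order \<open>\<beta>\<close> of
  \<open>\<psi> = frac_int \<kappa> (\<bar>g\<bar> - g) + \<omega> * w\<close>. At a point where \<open>w - G\<close> has a positive maximum,
  \<open>w > G \<ge> 0\<close> makes \<open>\<psi>\<close> positive, whereas the extremum principle makes it nonpositive.
\<close>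
lemma two_term_comparison:
  assumes \<beta>: "0 < \<beta>" "\<beta> < 1" and \<kappa>: "0 \<le> \<kappa>" and \<omega>: "0 < \<omega>"
    and w: "continuous_on {0..T} w" and g: "continuous_on {0..T} g"
    and eq: "\<And>t. t \<in> {0..T} \<Longrightarrow> w t + \<omega> * frac_int \<beta> w t = frac_int (\<beta> + \<kappa>) g t"
    and t: "t \<in> {0..T}"
  shows "w t \<le> frac_int (\<beta> + \<kappa>) (\<lambda>s. \<bar>g s\<bar>) t"
proof (rule ccontr)
  define G where "G = frac_int (\<beta> + \<kappa>) (\<lambda>s. \<bar>g s\<bar>)"
  assume "\<not> w t \<le> frac_int (\<beta> + \<kappa>) (\<lambda>s. \<bar>g s\<bar>) t"
  then have t_pos: "0 < w t - G t" by (simp add: G_def)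
  have abs_g: "continuous_on {0..T} (\<lambda>s. \<bar>g s\<bar>)" by (intro continuous_intros g)
  have G: "continuous_on {0..T} G"
    unfolding G_def using \<beta> \<kappa> by (intro continuous_on_frac_int abs_g) auto
  have "continuous_on {0..T} (\<lambda>s. w s - G s)" by (intro continuous_intros w G)
  then obtain r where r: "r \<in> {0..T}" and r_max: "\<And>s. s \<in> {0..T} \<Longrightarrow> w s - G s \<le> w r - G r"
    using continuous_attains_sup[of "{0..T}" "\<lambda>s. w s - G s"] t by auto
  define m where "m = w r - G r"
  have m: "0 < m" using t_pos r_max[OF t] by (simp add: m_def)
  have "w 0 - G 0 = 0"
    using eq[of 0] t \<beta> \<kappa> by (simp add: G_def frac_int_at_0)
  then have "0 < r" using m r by (cases "r = 0") (auto simp: m_def)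
  define \<psi> where "\<psi> s = frac_int \<kappa> (\<lambda>s. \<bar>g s\<bar> - g s) s + \<omega> * w s" for s
  have gg: "continuous_on {0..T} (\<lambda>s. \<bar>g s\<bar> - g s)" by (intro continuous_intros g)
  have sub: "continuous_on {0..s} h" if "continuous_on {0..T} h" "s \<in> {0..T}" for h :: "real \<Rightarrow> real" and s
    using that by (auto intro: continuous_on_subset)
  have Igg: "continuous_on {0..T} (frac_int \<kappa> (\<lambda>s. \<bar>g s\<bar> - g s))"
    using \<kappa> by (intro continuous_on_frac_int gg) auto
  have \<psi>_cont: "continuous_on {0..T} \<psi>"
    unfolding \<psi>_def by (intro continuous_intros w Igg)
  have \<psi>_int: "frac_int \<beta> \<psi> s = G s - w s" if s: "s \<in> {0..T}" for s
  proof -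
    have "frac_int \<beta> \<psi> s
        = frac_int \<beta> (frac_int \<kappa> (\<lambda>s. \<bar>g s\<bar> - g s)) s + \<omega> * frac_int \<beta> w s"
      unfolding \<psi>_def frac_int_cmult[symmetric]
      using \<beta> s by (intro frac_int_add continuous_intros sub[OF _ s] Igg w) auto
    also have "frac_int \<beta> (frac_int \<kappa> (\<lambda>s. \<bar>g s\<bar> - g s)) s
        = frac_int (\<beta> + \<kappa>) (\<lambda>s. \<bar>g s\<bar> - g s) s"
      by (rule frac_int_semigroup[OF \<beta>(1) \<kappa> gg s])
    also have "\<dots> = G s - frac_int (\<beta> + \<kappa>) g s"
      unfolding G_def using \<beta> \<kappa> by (intro frac_int_diff sub[OF _ s] abs_g g) auto
    finally show ?thesis using eq[OF s] by simp
  qed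
  have "\<psi> r \<le> 0"
  proof (rule frac_int_extremum_principle[OF \<beta> \<open>0 < r\<close>])
    show "continuous_on {0..r} \<psi>" by (rule sub[OF \<psi>_cont r])
    show "0 \<le> m" using m by simp
    show "frac_int \<beta> \<psi> r = - m" using \<psi>_int[OF r] by (simp add: m_def)
    show "- m \<le> frac_int \<beta> \<psi> s" if "s \<in> {0..r}" for s
      using \<psi>_int[of s] r_max[of s] that r by (simp add: m_def)
  qed
  moreover have "0 \<le> frac_int \<kappa> (\<lambda>s. \<bar>g s\<bar> - g s) r"
    using \<kappa> r by (intro frac_int_nonneg sub[OF gg r]) auto
  moreover have "0 \<le> G r"
    unfolding G_def using \<beta> \<kappa> r by (intro frac_int_nonneg sub[OF abs_g r]) auto
  then have "0 < \<omega> * w r" using m \<omega> by (simp add: m_def)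
  ultimately show False by (simp add: \<psi>_def)
qed

corollary two_term_abs_comparison:
  assumes \<beta>: "0 < \<beta>" "\<beta> < 1" and \<kappa>: "0 \<le> \<kappa>" and \<omega>: "0 < \<omega>"
    and w: "continuous_on {0..T} w" and g: "continuous_on {0..T} g"
    and eq: "\<And>t. t \<in> {0..T} \<Longrightarrow> w t + \<omega> * frac_int \<beta> w t = frac_int (\<beta> + \<kappa>) g t"
    and t: "t \<in> {0..T}"
  shows "\<bar>w t\<bar> \<le> frac_int (\<beta> + \<kappa>) (\<lambda>s. \<bar>g s\<bar>) t"
proof (rule abs_leI)
  show "w t \<le> frac_int (\<beta> + \<kappa>) (\<lambda>s. \<bar>g s\<bar>) t"
    by (rule two_term_comparison[OF \<beta> \<kappa> \<omega> w g eq t])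
  have "- w s + \<omega> * frac_int \<beta> (\<lambda>s. - w s) s = frac_int (\<beta> + \<kappa>) (\<lambda>s. - g s) s"
    if "s \<in> {0..T}" for s
    using eq[OF that] by (simp add: frac_int_minus)
  from two_term_comparison[OF \<beta> \<kappa> \<omega> continuous_on_minus[OF w] continuous_on_minus[OF g] this t]
  show "- w t \<le> frac_int (\<beta> + \<kappa>) (\<lambda>s. \<bar>g s\<bar>) t" by simp
qed

section \<open>Mittag-Leffler bound\<close>

text \<open>
  Restrict the Euler integral to \<open>{A..}\<close>, where the power is at least \<open>A powr y\<close>. As \<open>A\<close> is arbitrary, \<open>Gamma\<close>
  grows faster than every exponential.
\<close>
lemma Gamma_ge_powr:
  fixes A y :: real
  assumes "0 < A" "0 \<le> y"
  shows "A powr y * exp (- A) \<le> Gamma (y + 1)"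
proof -
  have "((\<lambda>t. exp (- t)) has_integral exp (- A)) {A..}"
    using has_integral_exp_minus_to_infinity[of 1 A] by simp
  then have "((\<lambda>t. A powr y * exp (- t)) has_integral A powr y * exp (- A)) {A..}"
    by (rule has_integral_mult_right)
  then have "((\<lambda>t. if t \<in> {A..} then A powr y * exp (- t) else 0) has_integral A powr y * exp (- A)) {0..}"
    by (subst has_integral_restrict) (use assms in auto)
  moreover have "((\<lambda>t. t powr y / exp t) has_integral Gamma (y + 1)) {0..}"
    using Gamma_integral_real[of "y + 1"] assms by simp
  ultimately show ?thesis
    by (rule has_integral_le) (use assms in \<open>auto simp: exp_minus divide_inverse intro!: powr_mono2\<close>)
qed

lemma mittag_leffler_summable:
  fixes p x :: real
  assumes "0 < p"
  shows "summable (\<lambda>k. x ^ k / Gamma (p * real k + 1))"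
proof (rule summable_comparison_test)
  \<comment> \<open>With \<open>A powr p = q > 2 * \<bar>x\<bar>\<close> the series is dominated by a geometric one with ratio \<open>1/2\<close>.\<close>
  define q where "q = 2 * (\<bar>x\<bar> + 1)"
  define A where "A = q powr (1 / p)"
  have q: "0 < q" by (simp add: q_def)
  then have A: "0 < A" by (simp add: A_def)
  have "norm (x ^ k / Gamma (p * real k + 1)) \<le> exp A * (1/2) ^ k" for k
  proof -
    have "A powr (p * real k) = q ^ k"
      using q assms by (simp add: A_def powr_powr powr_realpow)
    then have le: "q ^ k * exp (- A) \<le> Gamma (p * real k + 1)"
      using Gamma_ge_powr[of A "p * real k"] A assms by simp
    have "\<bar>x\<bar> ^ k \<le> (1/2 * q) ^ k"
      by (rule power_mono) (auto simp: q_def)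
    also have "\<dots> = exp A * (1/2) ^ k * (q ^ k * exp (- A))"
      by (simp add: power_mult_distrib exp_minus field_simps)
    also have "\<dots> \<le> exp A * (1/2) ^ k * Gamma (p * real k + 1)"
      by (rule mult_left_mono[OF le]) simp
    finally have "\<bar>x\<bar> ^ k \<le> exp A * (1/2) ^ k * Gamma (p * real k + 1)" .
    moreover have "0 < Gamma (p * real k + 1)"
      using assms by (intro Gamma_real_pos) (simp add: add_nonneg_pos)
    ultimately show ?thesis
      by (simp add: power_abs divide_le_eq abs_divide)
  qed
  then show "\<exists>N. \<forall>k\<ge>N. norm (x ^ k / Gamma (p * real k + 1)) \<le> exp A * (1/2) ^ k" by blast
  show "summable (\<lambda>k. exp A * (1/2) ^ k :: real)"
    by (intro summable_mult summable_geometric) simp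
qed

text \<open>
  Integration of order \<open>\<mu>\<close> shifts the Mittag-Leffler series by one term. Powers are written as
  \<open>(s powr \<mu>) ^ k\<close>, for which the term \<open>k = 0\<close> is \<open>1\<close> also at \<open>s = 0\<close>.
\<close>
lemma frac_int_mittag_leffler_term:
  fixes L \<mu> t :: real
  assumes "0 < \<mu>" "0 \<le> t"
  shows "L * frac_int \<mu> (\<lambda>s. (L * s powr \<mu>) ^ k / Gamma (\<mu> * real k + 1)) t
       = (L * t powr \<mu>) ^ Suc k / Gamma (\<mu> * real (Suc k) + 1)"
proof -
  have \<Gamma>: "Gamma (\<mu> * real k + 1) \<noteq> 0"
    using assms by (intro Gamma_real_nonzero) (simp add: add_nonneg_pos)
  have pow: "(s powr \<mu>) ^ j = s powr (\<mu> * real j)" if "0 < s" for s :: real and j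
    using that by (simp add: powr_powr[symmetric] powr_realpow)
  have "frac_int \<mu> (\<lambda>s. (L * s powr \<mu>) ^ k / Gamma (\<mu> * real k + 1)) t
      = frac_int \<mu> (\<lambda>s. L ^ k / Gamma (\<mu> * real k + 1) * s powr (\<mu> * real k)) t"
    by (rule frac_int_spike) (use assms in \<open>auto simp: power_mult_distrib pow\<close>)
  also have "\<dots> = L ^ k / Gamma (\<mu> * real k + 1) *
      (Gamma (\<mu> * real k + 1) / Gamma (\<mu> * real k + 1 + \<mu>) * t powr (\<mu> * real k + \<mu>))"
    unfolding frac_int_cmult using assms
    by (subst frac_int_powr) (auto intro: less_le_trans[of "-1" 0])
  also have "\<dots> = L ^ k * t powr (\<mu> * real (Suc k)) / Gamma (\<mu> * real (Suc k) + 1)"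
    using \<Gamma> by (simp add: algebra_simps)
  also have "t powr (\<mu> * real (Suc k)) = (t powr \<mu>) ^ Suc k"
    using pow[of t "Suc k"] assms by (cases "t = 0") auto
  finally show ?thesis by (simp add: power_mult_distrib)
qed

text \<open>
  Feeding the bound back into the hypothesis \<open>n\<close> times, starting from a crude bound \<open>M\<close> for \<open>\<bar>u\<bar>\<close>, produces
  the \<open>n\<close>-th partial sum of the series and a remainder that is \<open>M\<close> times the next term, hence tends to \<open>0\<close>.
\<close>
lemma fractional_gronwall:
  assumes \<mu>: "0 < \<mu>" and L: "0 \<le> L" and c: "0 \<le> c" and u: "continuous_on {0..T} u"
    and le: "\<And>t. t \<in> {0..T} \<Longrightarrow> \<bar>u t\<bar> \<le> c + L * frac_int \<mu> (\<lambda>s. \<bar>u s\<bar>) t"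
    and t: "t \<in> {0..T}"
  shows "\<bar>u t\<bar> \<le> c * mittag_leffler \<mu> (L * t powr \<mu>)"
proof -
  define e where "e k s = (L * s powr \<mu>) ^ k / Gamma (\<mu> * real k + 1)" for k s
  have e_cont: "continuous_on {0..s} (e k)" for k s
  proof -
    have "continuous_on {0..s} (\<lambda>r. r powr \<mu>)"
      using \<mu> by (intro continuous_on_powr' continuous_on_id continuous_on_const) auto
    moreover have "Gamma (\<mu> * real k + 1) \<noteq> 0"
      using \<mu> by (intro Gamma_real_nonzero) (simp add: add_nonneg_pos)
    ultimately show ?thesis
      unfolding e_def
      by (intro continuous_on_divide continuous_on_power continuous_on_mult continuous_on_const) auto
  qed
  have e_step: "L * frac_int \<mu> (e k) s = e (Suc k) s" if "0 \<le> s" for k s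
    using frac_int_mittag_leffler_term[OF \<mu> that] by (simp add: e_def[abs_def])
  have u_abs: "continuous_on {0..T} (\<lambda>s. \<bar>u s\<bar>)" by (intro continuous_intros u)
  obtain M where M: "\<And>s. s \<in> {0..T} \<Longrightarrow> \<bar>u s\<bar> \<le> M"
    using compact_imp_bounded[OF compact_continuous_image[OF u compact_Icc]]
    unfolding bounded_iff by (metis image_eqI real_norm_def)
  have iter: "\<bar>u s\<bar> \<le> c * (\<Sum>k<n. e k s) + M * e n s" if "s \<in> {0..T}" for n s
    using that
  proof (induction n arbitrary: s)
    case 0
    then show ?case using M by (simp add: e_def)
  next
    case (Suc n)
    then have s: "0 \<le> s" "s \<le> T" by auto
    have "frac_int \<mu> (\<lambda>s. \<bar>u s\<bar>) s \<le> frac_int \<mu> (\<lambda>s. c * (\<Sum>k<n. e k s) + M * e n s) s"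
      by (rule frac_int_mono)
         (use \<mu> s Suc.IH in \<open>auto intro!: continuous_intros e_cont continuous_on_subset[OF u]\<close>)
    also have "\<dots> = frac_int \<mu> (\<lambda>s. c * (\<Sum>k<n. e k s)) s + frac_int \<mu> (\<lambda>s. M * e n s) s"
      using \<mu> by (intro frac_int_add continuous_intros e_cont) auto
    also have "\<dots> = c * (\<Sum>k<n. frac_int \<mu> (e k) s) + M * frac_int \<mu> (e n) s"
      using \<mu> by (simp add: frac_int_cmult frac_int_sum e_cont)
    finally have "L * frac_int \<mu> (\<lambda>s. \<bar>u s\<bar>) s
        \<le> L * (c * (\<Sum>k<n. frac_int \<mu> (e k) s) + M * frac_int \<mu> (e n) s)"
      using L by (rule mult_left_mono)
    also have "\<dots> = c * (\<Sum>k<n. L * frac_int \<mu> (e k) s) + M * (L * frac_int \<mu> (e n) s)"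
      by (simp add: sum_distrib_left algebra_simps)
    also have "\<dots> = c * (\<Sum>k<n. e (Suc k) s) + M * e (Suc n) s"
      using s by (simp add: e_step)
    finally have "\<bar>u s\<bar> \<le> c + (c * (\<Sum>k<n. e (Suc k) s) + M * e (Suc n) s)"
      using le[of s] Suc.prems by simp
    also have "\<dots> = c * (\<Sum>k<Suc n. e k s) + M * e (Suc n) s"
      unfolding sum.lessThan_Suc_shift by (simp add: e_def distrib_left)
    finally show ?case .
  qed
  have sm: "summable (\<lambda>k. e k t)"
    unfolding e_def by (rule mittag_leffler_summable[OF \<mu>])
  have "(\<lambda>n. c * (\<Sum>k<n. e k t) + M * e n t) \<longlonglongrightarrow> c * (\<Sum>k. e k t) + M * 0"
    by (intro tendsto_intros summable_LIMSEQ[OF sm] summable_LIMSEQ_zero[OF sm])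
  then have "\<bar>u t\<bar> \<le> c * (\<Sum>k. e k t) + M * 0"
    by (rule LIMSEQ_le_const) (use iter[OF t] in blast)
  then show ?thesis by (simp add: e_def mittag_leffler_def)
qed

lemma mittag_leffler_mono:
  assumes "0 < p" "0 \<le> x" "x \<le> y"
  shows "mittag_leffler p x \<le> mittag_leffler p y"
  unfolding mittag_leffler_def
proof (rule suminf_le)
  fix k
  have "0 < Gamma (p * real k + 1)"
    using assms by (intro Gamma_real_pos) (simp add: add_nonneg_pos)
  then show "x ^ k / Gamma (p * real k + 1) \<le> y ^ k / Gamma (p * real k + 1)"
    using assms by (intro divide_right_mono power_mono) auto
qed (use assms mittag_leffler_summable in auto)

section \<open>Change of time\<close>

lemma C1_on_has_vector_derivative:
  assumes "C1_on a b f" "l \<in> {a..b}"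
  shows "(f has_vector_derivative deriv_on a b f l) (at l within {a..b})"
  using assms
  by (auto simp: C1_on_def deriv_on_def differentiable_on_def vector_derivative_works)

lemma continuous_on_superposition:
  assumes F: "continuous_on (S \<times> UNIV) (\<lambda>(l, y). F l y)" and y: "continuous_on S y"
  shows "continuous_on S (\<lambda>l. F l (y l))"
proof -
  have "continuous_on S (\<lambda>l. (l, y l))" by (intro continuous_intros y)
  from continuous_on_compose2[OF F this] show ?thesis by auto
qed

text \<open>
  The hypotheses on \<open>\<Phi>\<close>, which make \<open>clock\<close> below a homeomorphism of \<open>{a..b}\<close> onto \<open>{0..\<Phi> b - \<Phi> a}\<close>.
\<close>
locale fractional_clock =
  fixes a b :: real and \<Phi> :: "real \<Rightarrow> real"
  assumes ab: "a < b" and C1: "C1_on a b \<Phi>" and mono: "mono_on {a..b} \<Phi>"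
    and deriv_nonzero: "\<And>l. l \<in> {a..b} \<Longrightarrow> deriv_on a b \<Phi> l \<noteq> 0"
begin

definition clock :: "real \<Rightarrow> real" where "clock l = \<Phi> l - \<Phi> a"

definition unclock :: "real \<Rightarrow> real" where "unclock = inv_into {a..b} clock"

lemma clock_has_derivative:
  assumes "l \<in> {a..b}"
  shows "(clock has_field_derivative deriv_on a b \<Phi> l) (at l within {a..b})"
proof -
  have "(\<Phi> has_field_derivative deriv_on a b \<Phi> l) (at l within {a..b})"
    using C1_on_has_vector_derivative[OF C1 assms]
    by (simp add: has_real_derivative_iff_has_vector_derivative)
  from DERIV_diff[OF this DERIV_const[of "\<Phi> a"]] show ?thesis
    by (simp add: clock_def[abs_def])
qed

lemma deriv_pos:
  assumes "l \<in> {a..b}"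
  shows "0 < deriv_on a b \<Phi> l"
proof -
  have "((\<lambda>y. (clock y - clock l) / (y - l)) \<longlongrightarrow> deriv_on a b \<Phi> l) (at l within {a..b})"
    using clock_has_derivative[OF assms] by (simp add: has_field_derivative_iff)
  moreover have "0 \<le> (clock y - clock l) / (y - l)" if "y \<in> {a..b}" for y
    using mono_onD[OF mono that assms] mono_onD[OF mono assms that]
    by (cases "y \<le> l") (auto simp: clock_def divide_nonpos_nonpos)
  then have "\<forall>\<^sub>F y in at l within {a..b}. 0 \<le> (clock y - clock l) / (y - l)"
    by (auto simp: eventually_at intro!: exI[of _ 1])
  moreover have "at l within {a..b} \<noteq> bot"
    using ab assms by (simp add: trivial_limit_within islimpt_Icc)
  ultimately have "0 \<le> deriv_on a b \<Phi> l"
    by (rule tendsto_lowerbound)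
  with deriv_nonzero[OF assms] show ?thesis by simp
qed

lemma continuous_clock: "continuous_on {a..b} clock"
  using clock_has_derivative DERIV_continuous_on by blast

lemma clock_strict: "clock x < clock y" if "a \<le> x" "x < y" "y \<le> b"
proof (rule DERIV_pos_imp_increasing_open[OF that(2)])
  show "continuous_on {x..y} clock"
    by (rule continuous_on_subset[OF continuous_clock]) (use that in auto)
  fix r assume r: "x < r" "r < y"
  then have "r \<in> interior {a..b}" "r \<in> {a..b}" using that by auto
  then show "\<exists>d. (clock has_real_derivative d) (at r) \<and> 0 < d"
    using clock_has_derivative deriv_pos at_within_interior by metis
qed

lemma inj_clock: "inj_on clock {a..b}"
  by (rule linorder_inj_onI) (use clock_strict in force)+

lemma clock_mono: "clock x \<le> clock y" if "a \<le> x" "x \<le> y" "y \<le> b"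
  using clock_strict[of x y] that by (cases "x = y") auto

lemma clock_image: "clock ` {a..l} = {0..clock l}" if l: "l \<in> {a..b}"
proof
  show "clock ` {a..l} \<subseteq> {0..clock l}"
    using clock_mono[of a] clock_mono[of _ l] l by (auto simp: clock_def)
  show "{0..clock l} \<subseteq> clock ` {a..l}"
  proof
    fix s assume "s \<in> {0..clock l}"
    moreover have "clock a = 0" by (simp add: clock_def)
    moreover have "continuous_on {a..l} clock"
      by (rule continuous_on_subset[OF continuous_clock]) (use l in auto)
    ultimately obtain x where "a \<le> x" "x \<le> l" "clock x = s"
      using IVT'[of clock a s l] l by auto
    then show "s \<in> clock ` {a..l}" by auto
  qed
qed

lemma unclock_clock: "unclock (clock l) = l" if "l \<in> {a..b}"
  unfolding unclock_def using inv_into_f_f[OF inj_clock that] .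

lemma clock_range: "clock l \<in> {0..clock b}" if "l \<in> {a..b}"
  using clock_image[of b] that ab by auto

lemma clock_unclock:
  assumes "t \<in> {0..clock b}"
  shows "unclock t \<in> {a..b}" "clock (unclock t) = t"
proof -
  have "t \<in> clock ` {a..b}" using assms clock_image[of b] ab by simp
  then show "unclock t \<in> {a..b}" "clock (unclock t) = t"
    unfolding unclock_def by (rule inv_into_into, rule f_inv_into_f)
qed

lemma continuous_unclock: "continuous_on {0..clock b} unclock"
  using continuous_on_inv[OF continuous_clock compact_Icc, of unclock] unclock_clock
    clock_image[of b] ab by auto

lemma continuous_on_unclock:
  assumes "continuous_on {a..b} f"
  shows "continuous_on {0..clock b} (\<lambda>t. f (unclock t))"
  by (rule continuous_on_compose2[OF assms continuous_unclock]) (use clock_unclock in blast)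

lemma RL_integral_eq_frac_int:
  assumes \<gamma>: "0 \<le> \<gamma>" and f: "continuous_on {a..b} f" and l: "l \<in> {a..b}"
  shows "RL_integral a b \<Phi> \<gamma> f l = frac_int \<gamma> (\<lambda>t. f (unclock t)) (clock l)"
proof (cases "\<gamma> = 0")
  case True
  then show ?thesis using unclock_clock[OF l] by (simp add: RL_integral_def frac_int_def)
next
  case False
  with \<gamma> have \<gamma>: "0 < \<gamma>" by simp
  define h where "h s = (clock l - s) powr (\<gamma> - 1) * f (unclock s)" for s
  define k where "k \<rho> = deriv_on a b \<Phi> \<rho> * (\<Phi> l - \<Phi> \<rho>) powr (\<gamma> - 1) * f \<rho>" for \<rho>
  have sub: "{a..l} \<subseteq> {a..b}" using l by auto
  have "h absolutely_integrable_on {0..clock l}"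
    unfolding h_def using \<gamma> clock_range[OF l]
    by (intro kernel_times_absolutely_integrable continuous_on_subset[OF continuous_on_unclock[OF f]]) auto
  then have "h absolutely_integrable_on clock ` {a..l} \<and> integral (clock ` {a..l}) h = integral {0..clock l} h"
    by (simp add: clock_image[OF l])
  moreover have "(clock has_field_derivative deriv_on a b \<Phi> \<rho>) (at \<rho> within {a..l})" if "\<rho> \<in> {a..l}" for \<rho>
    using clock_has_derivative[of \<rho>] that sub by (auto intro: DERIV_subset)
  moreover have "inj_on clock {a..l}"
    by (rule inj_on_subset[OF inj_clock sub])
  ultimately have A: "(\<lambda>\<rho>. \<bar>deriv_on a b \<Phi> \<rho>\<bar> * h (clock \<rho>)) absolutely_integrable_on {a..l}"
    and B: "integral {a..l} (\<lambda>\<rho>. \<bar>deriv_on a b \<Phi> \<rho>\<bar> * h (clock \<rho>)) = integral {0..clock l} h"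
    using has_absolute_integral_change_of_variables_1'[of "{a..l}" clock "deriv_on a b \<Phi>" h] by auto
  have eq: "\<bar>deriv_on a b \<Phi> \<rho>\<bar> * h (clock \<rho>) = k \<rho>" if "\<rho> \<in> {a..l}" for \<rho>
    using deriv_pos[of \<rho>] unclock_clock[of \<rho>] that sub by (auto simp: h_def k_def clock_def)
  have "(LINT \<rho>:{a..l}|lebesgue. k \<rho>)
      = (LINT \<rho>:{a..l}|lebesgue. \<bar>deriv_on a b \<Phi> \<rho>\<bar> * h (clock \<rho>))"
    unfolding set_lebesgue_integral_def
    by (rule Bochner_Integration.integral_cong) (auto simp: indicator_def eq)
  also have "\<dots> = integral {0..clock l} h"
    using set_lebesgue_integral_eq_integral(2)[OF A] B by simp
  finally show ?thesis
    using \<gamma> unfolding RL_integral_def frac_int_def h_def k_def by simp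
qed

text \<open>
  At order one the kernel \<open>(\<Phi> l - \<Phi> \<rho>) powr 0\<close> equals \<open>1\<close> except at \<open>\<rho> = l\<close>.
\<close>
lemma RL_integral_1:
  assumes f: "continuous_on {a..b} f" and l: "l \<in> {a..b}"
    and int: "((\<lambda>\<rho>. deriv_on a b \<Phi> \<rho> * f \<rho>) has_integral i) {a..l}"
  shows "RL_integral a b \<Phi> 1 f l = i"
proof -
  have "continuous_on {a..l} (\<lambda>\<rho>. deriv_on a b \<Phi> \<rho> * f \<rho>)"
    using C1 f l by (intro continuous_intros) (auto simp: C1_on_def intro: continuous_on_subset)
  then have "(\<lambda>\<rho>. deriv_on a b \<Phi> \<rho> * f \<rho>) absolutely_integrable_on {a..l}"
    by (rule absolutely_integrable_continuous_real)
  then have "(\<lambda>\<rho>. deriv_on a b \<Phi> \<rho> * (\<Phi> l - \<Phi> \<rho>) powr (1 - 1) * f \<rho>) absolutely_integrable_on {a..l}"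
  proof (rule absolutely_integrable_spike[of _ _ "{l}"])
    fix \<rho> assume "\<rho> \<in> {a..l} - {l}"
    then show "deriv_on a b \<Phi> \<rho> * (\<Phi> l - \<Phi> \<rho>) powr (1 - 1) * f \<rho> = deriv_on a b \<Phi> \<rho> * f \<rho>"
      using clock_strict[of \<rho> l] l by (auto simp: clock_def)
  qed auto
  then have "RL_integral a b \<Phi> 1 f l
      = integral {a..l} (\<lambda>\<rho>. deriv_on a b \<Phi> \<rho> * (\<Phi> l - \<Phi> \<rho>) powr (1 - 1) * f \<rho>)"
    using set_lebesgue_integral_eq_integral(2) by (simp add: RL_integral_def)
  also have "\<dots> = integral {a..l} (\<lambda>\<rho>. deriv_on a b \<Phi> \<rho> * f \<rho>)"
  proof (rule integral_spike[of "{l}"])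
    fix \<rho> assume "\<rho> \<in> {a..l} - {l}"
    then show "deriv_on a b \<Phi> \<rho> * f \<rho> = deriv_on a b \<Phi> \<rho> * (\<Phi> l - \<Phi> \<rho>) powr (1 - 1) * f \<rho>"
      using clock_strict[of \<rho> l] l by (auto simp: clock_def)
  qed auto
  finally show ?thesis using int by (simp add: integral_unique)
qed

text \<open>
  Multiplied by \<open>\<Phi>'\<close>, the equation equates continuous derivatives, and the functions differentiated in the Caputo
  derivatives vanish at \<open>a\<close>. The fundamental theorem of calculus removes the derivatives, and the change of time
  removes \<open>\<Phi>\<close>.
\<close>
lemma solution_integrated:
  assumes sol: "is_solution a b \<Phi> \<mu> \<kappa> \<omega> F za z"
    and \<mu>: "\<mu> \<le> 1" and \<kappa>: "\<kappa> \<le> 1"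
    and F: "continuous_on ({a..b} \<times> UNIV) (\<lambda>(l, y). F l y)"
    and t: "t \<in> {0..clock b}"
  shows "frac_int (1 - \<mu>) (\<lambda>s. z (unclock s) - za) t
       + \<omega> * frac_int (1 - \<kappa>) (\<lambda>s. z (unclock s) - za) t
       = frac_int 1 (\<lambda>s. F (unclock s) (z (unclock s))) t"
proof -
  define v where "v \<rho> = z \<rho> - z a" for \<rho>
  define J where "J \<gamma> = RL_integral a b \<Phi> (1 - \<gamma>) v" for \<gamma>
  define l where "l = unclock t"
  have l: "l \<in> {a..b}" and tl: "clock l = t" using clock_unclock[OF t] by (simp_all add: l_def)
  have z: "continuous_on {a..b} z" and za: "z a = za"
    and C1s: "C1_on a b (J \<mu>)" "C1_on a b (J \<kappa>)"
    and eq: "\<And>\<rho>. \<rho> \<in> {a..b} \<Longrightarrow>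
        caputo a b \<Phi> \<mu> z \<rho> + \<omega> * caputo a b \<Phi> \<kappa> z \<rho> = F \<rho> (z \<rho>)"
    using sol by (auto simp: is_solution_def caputo_continuous_def J_def v_def[abs_def])
  have v: "continuous_on {a..b} v" unfolding v_def by (intro continuous_intros z)
  have Fz: "continuous_on {a..b} (\<lambda>\<rho>. F \<rho> (z \<rho>))"
    by (rule continuous_on_superposition[OF F z])
  have J_frac: "J \<gamma> \<rho> = frac_int (1 - \<gamma>) (\<lambda>s. v (unclock s)) (clock \<rho>)"
    if "\<gamma> \<le> 1" "\<rho> \<in> {a..b}" for \<gamma> \<rho>
    unfolding J_def using that by (intro RL_integral_eq_frac_int v) auto
  have J_a: "J \<gamma> a = 0" if "\<gamma> \<le> 1" for \<gamma>
    using J_frac[OF that, of a] ab unclock_clock[of a]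
    by (cases "\<gamma> = 1") (auto simp: frac_int_def clock_def v_def)
  have "((\<lambda>\<rho>. deriv_on a b \<Phi> \<rho> * F \<rho> (z \<rho>)) has_integral
      (J \<mu> l + \<omega> * J \<kappa> l - (J \<mu> a + \<omega> * J \<kappa> a))) {a..l}"
  proof (rule fundamental_theorem_of_calculus)
    show "a \<le> l" using l by simp
    fix \<rho> assume \<rho>: "\<rho> \<in> {a..l}"
    with l have \<rho>': "\<rho> \<in> {a..b}" by auto
    have "((\<lambda>r. J \<mu> r + \<omega> * J \<kappa> r) has_vector_derivative
        deriv_on a b (J \<mu>) \<rho> + \<omega> * deriv_on a b (J \<kappa>) \<rho>) (at \<rho> within {a..b})"
      by (intro has_vector_derivative_add has_vector_derivative_mult_right
          C1_on_has_vector_derivative C1s \<rho>')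
    also have "deriv_on a b (J \<mu>) \<rho> + \<omega> * deriv_on a b (J \<kappa>) \<rho> = deriv_on a b \<Phi> \<rho> * F \<rho> (z \<rho>)"
      using eq[OF \<rho>', symmetric] deriv_pos[OF \<rho>']
      by (simp add: caputo_def J_def v_def[abs_def] field_simps)
    finally show "((\<lambda>r. J \<mu> r + \<omega> * J \<kappa> r) has_vector_derivative deriv_on a b \<Phi> \<rho> * F \<rho> (z \<rho>))
        (at \<rho> within {a..l})"
      by (rule has_vector_derivative_within_subset) (use l in auto)
  qed
  from RL_integral_1[OF Fz l this] have "RL_integral a b \<Phi> 1 (\<lambda>\<rho>. F \<rho> (z \<rho>)) l = J \<mu> l + \<omega> * J \<kappa> l"
    using J_a \<mu> \<kappa> by simp
  then show ?thesis
    using RL_integral_eq_frac_int[OF _ Fz l, of 1] J_frac[OF \<mu> l] J_frac[OF \<kappa> l] za tl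
    by (simp add: v_def)
qed

end

section \<open>Stability with respect to the initial value\<close>

text \<open>
  Integrating once more with order \<open>\<mu>\<close> turns all three orders \<open>1 - \<mu>\<close>, \<open>1 - \<kappa>\<close> and \<open>1\<close> into \<open>1\<close> plus the order
  wanted, by the semigroup property; the common integral of order one is then cancelled.
\<close>
lemma integrated_equation_to_resolvent_form:
  assumes \<mu>: "0 < \<mu>" "\<mu> \<le> 1" and \<kappa>: "\<kappa> < \<mu>" and T: "0 < T"
    and w: "continuous_on {0..T} w" and g: "continuous_on {0..T} g"
    and eq: "\<And>t. t \<in> {0..T} \<Longrightarrow>
      frac_int (1 - \<mu>) w t + \<omega> * frac_int (1 - \<kappa>) w t = frac_int 1 g t"
    and t: "t \<in> {0..T}"
  shows "w t + \<omega> * frac_int (\<mu> - \<kappa>) w t = frac_int \<mu> g t"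
proof -
  define r where "r s = w s + \<omega> * frac_int (\<mu> - \<kappa>) w s - frac_int \<mu> g s" for s
  have sub: "continuous_on {0..s} h" if "continuous_on {0..T} h" "s \<in> {0..T}" for h :: "real \<Rightarrow> real" and s
    using that by (auto intro: continuous_on_subset)
  have Iw: "continuous_on {0..T} (frac_int \<gamma> w)" and Ig: "continuous_on {0..T} (frac_int \<gamma> g)"
    if "0 \<le> \<gamma>" for \<gamma>
    using that w g by (auto intro: continuous_on_frac_int)
  have "frac_int 1 r s = 0" if s: "s \<in> {0..T}" for s
  proof -
    have "frac_int 1 r s = frac_int 1 (\<lambda>s. w s + \<omega> * frac_int (\<mu> - \<kappa>) w s) s - frac_int 1 (frac_int \<mu> g) s"
      unfolding r_def using \<mu> \<kappa>
      by (intro frac_int_diff sub[OF _ s] continuous_intros w Iw Ig) auto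
    also have "frac_int 1 (\<lambda>s. w s + \<omega> * frac_int (\<mu> - \<kappa>) w s) s
        = frac_int 1 w s + \<omega> * frac_int 1 (frac_int (\<mu> - \<kappa>) w) s"
      unfolding frac_int_cmult[symmetric] using \<mu> \<kappa>
      by (intro frac_int_add sub[OF _ s] continuous_on_frac_int continuous_intros w) auto
    also have "frac_int 1 w s = frac_int \<mu> (frac_int (1 - \<mu>) w) s"
      using frac_int_semigroup[of \<mu> "1 - \<mu>" T w s] \<mu> w s by simp
    also have "frac_int 1 (frac_int (\<mu> - \<kappa>) w) s = frac_int \<mu> (frac_int (1 - \<kappa>) w) s"
    proof -
      have "frac_int (\<mu> + (1 - \<kappa>)) w s = frac_int (1 + (\<mu> - \<kappa>)) w s"
        by (simp add: algebra_simps)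
      then show ?thesis
        using frac_int_semigroup[of \<mu> "1 - \<kappa>" T w s]
          frac_int_semigroup[of 1 "\<mu> - \<kappa>" T w s] \<mu> \<kappa> w s
        by simp
    qed
    also have "frac_int 1 (frac_int \<mu> g) s = frac_int \<mu> (frac_int 1 g) s"
      using frac_int_semigroup[of \<mu> 1 T g s] frac_int_semigroup[of 1 \<mu> T g s] \<mu> g s
      by (simp add: add.commute)
    also have "frac_int \<mu> (frac_int 1 g) s
        = frac_int \<mu> (\<lambda>s. frac_int (1 - \<mu>) w s + \<omega> * frac_int (1 - \<kappa>) w s) s"
      by (rule frac_int_cong) (use eq s in auto)
    also have "\<dots> = frac_int \<mu> (frac_int (1 - \<mu>) w) s + \<omega> * frac_int \<mu> (frac_int (1 - \<kappa>) w) s"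
      unfolding frac_int_cmult[symmetric] using \<mu> \<kappa>
      by (intro frac_int_add sub[OF _ s] continuous_on_frac_int continuous_intros w) auto
    finally show ?thesis by simp
  qed
  moreover have "continuous_on {0..T} r"
    unfolding r_def using \<mu> \<kappa> by (intro continuous_intros w Iw Ig) auto
  ultimately have "r t = 0"
    using frac_int_1_eq_0_imp[OF T] t by blast
  then show ?thesis by (simp add: r_def)
qed

theorem theorem2:
  fixes a b \<mu> \<kappa> \<omega> L za za' :: real
    and \<Phi> z z' :: "real \<Rightarrow> real"
    and F :: "real \<Rightarrow> real \<Rightarrow> real"
  assumes "0 \<le> a" and "a < b"
    and "C1_on a b \<Phi>" and "mono_on {a..b} \<Phi>"
    and "\<And>l. l \<in> {a..b} \<Longrightarrow> deriv_on a b \<Phi> l \<noteq> 0"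
    and "0 < \<kappa>" and "\<kappa> < \<mu>" and "\<mu> \<le> 1" and "0 < \<omega>"
    and "continuous_on ({a..b} \<times> UNIV) (\<lambda>(l, y). F l y)"
    and "0 < L"
    and "\<And>l x y. l \<in> {a..b} \<Longrightarrow> \<bar>F l y - F l x\<bar> \<le> L * \<bar>y - x\<bar>"
    and "is_solution a b \<Phi> \<mu> \<kappa> \<omega> F za z"
    and "is_solution a b \<Phi> \<mu> \<kappa> \<omega> F za' z'"
  shows "(SUP l\<in>{a..b}. \<bar>z l - z' l\<bar>)
           \<le> mittag_leffler \<mu> (L * (\<Phi> b - \<Phi> a) powr \<mu>) * \<bar>za - za'\<bar>"
proof -
  interpret fractional_clock a b \<Phi>
    using assms(2-5) by unfold_locales
  have \<mu>: "0 < \<mu>" and \<kappa>: "\<kappa> \<le> 1" using assms(6-8) by auto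
  define T where "T = clock b"
  have T: "0 < T" using clock_strict[of a b] assms(2) by (simp add: T_def clock_def)
  have z: "continuous_on {a..b} z" and z': "continuous_on {a..b} z'"
    using assms(13,14) by (auto simp: is_solution_def)
  have F_cont: "continuous_on {0..T} (\<lambda>s. F (unclock s) (y (unclock s)))"
    if "continuous_on {a..b} y" for y
    unfolding T_def by (rule continuous_on_unclock[OF continuous_on_superposition[OF assms(10) that]])
  define u where "u s = z (unclock s) - z' (unclock s)" for s
  define w where "w s = (z (unclock s) - za) - (z' (unclock s) - za')" for s
  define g where "g s = F (unclock s) (z (unclock s)) - F (unclock s) (z' (unclock s))" for s
  note z_clock = continuous_on_unclock[OF z, folded T_def] continuous_on_unclock[OF z', folded T_def]
  have u: "continuous_on {0..T} u" and w: "continuous_on {0..T} w" and g: "continuous_on {0..T} g"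
    unfolding u_def w_def g_def by (intro continuous_intros z_clock F_cont z z')+
  have u_w: "u s = (za - za') + w s" for s by (simp add: u_def w_def)
  have sub: "continuous_on {0..t} h" if "continuous_on {0..T} h" "t \<in> {0..T}" for h :: "real \<Rightarrow> real" and t
    using that by (auto intro: continuous_on_subset)
  have "frac_int (1 - \<mu>) w t + \<omega> * frac_int (1 - \<kappa>) w t = frac_int 1 g t" if t: "t \<in> {0..T}" for t
  proof -
    have w_diff: "frac_int \<gamma> w t = frac_int \<gamma> (\<lambda>s. z (unclock s) - za) t
        - frac_int \<gamma> (\<lambda>s. z' (unclock s) - za') t" if "0 \<le> \<gamma>" for \<gamma>
      unfolding w_def using that by (intro frac_int_diff sub[OF _ t] continuous_intros z_clock)
    have g_diff: "frac_int 1 g t = frac_int 1 (\<lambda>s. F (unclock s) (z (unclock s))) t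
        - frac_int 1 (\<lambda>s. F (unclock s) (z' (unclock s))) t"
      unfolding g_def by (intro frac_int_diff sub[OF _ t] F_cont z z') simp
    have t': "t \<in> {0..clock b}" using t by (simp add: T_def)
    have "0 \<le> 1 - \<mu>" "0 \<le> 1 - \<kappa>" using assms(8) \<kappa> by simp_all
    then show ?thesis
      using solution_integrated[OF assms(13) assms(8) \<kappa> assms(10) t']
        solution_integrated[OF assms(14) assms(8) \<kappa> assms(10) t']
      unfolding g_diff by (simp only: w_diff right_diff_distrib)
  qed
  then have "w t + \<omega> * frac_int (\<mu> - \<kappa>) w t = frac_int \<mu> g t" if "t \<in> {0..T}" for t
    by (rule integrated_equation_to_resolvent_form[OF \<mu> assms(8,7) T w g _ that])
  then have w_le: "\<bar>w t\<bar> \<le> frac_int \<mu> (\<lambda>s. \<bar>g s\<bar>) t" if "t \<in> {0..T}" for t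
    using two_term_abs_comparison[of "\<mu> - \<kappa>" \<kappa> \<omega> T w g t] assms(6-9) w g that by simp
  have u_le: "\<bar>u t\<bar> \<le> \<bar>za - za'\<bar> + L * frac_int \<mu> (\<lambda>s. \<bar>u s\<bar>) t" if t: "t \<in> {0..T}" for t
  proof -
    have "frac_int \<mu> (\<lambda>s. \<bar>g s\<bar>) t \<le> frac_int \<mu> (\<lambda>s. L * \<bar>u s\<bar>) t"
    proof (rule frac_int_mono)
      show "continuous_on {0..t} (\<lambda>s. \<bar>g s\<bar>)" "continuous_on {0..t} (\<lambda>s. L * \<bar>u s\<bar>)"
        by (intro sub[OF _ t] continuous_intros g u)+
      show "\<bar>g s\<bar> \<le> L * \<bar>u s\<bar>" if "0 \<le> s" "s \<le> t" for s
        unfolding g_def u_def using that t by (intro assms(12) clock_unclock) (auto simp: T_def)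
    qed (use \<mu> t in auto)
    then have "\<bar>w t\<bar> \<le> L * frac_int \<mu> (\<lambda>s. \<bar>u s\<bar>) t"
      using w_le[OF t] by (simp add: frac_int_cmult)
    then show ?thesis unfolding u_w[of t] by linarith
  qed
  have "\<bar>z l - z' l\<bar> \<le> mittag_leffler \<mu> (L * (\<Phi> b - \<Phi> a) powr \<mu>) * \<bar>za - za'\<bar>"
    if l: "l \<in> {a..b}" for l
  proof -
    have t: "clock l \<in> {0..T}" using clock_range[OF l] by (simp add: T_def)
    have "\<bar>z l - z' l\<bar> = \<bar>u (clock l)\<bar>" by (simp add: u_def unclock_clock[OF l])
    also have "\<dots> \<le> \<bar>za - za'\<bar> * mittag_leffler \<mu> (L * clock l powr \<mu>)"
      using fractional_gronwall[OF \<mu> _ _ u u_le t] assms(11) by simp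
    also have "\<dots> \<le> \<bar>za - za'\<bar> * mittag_leffler \<mu> (L * T powr \<mu>)"
      using t \<mu> assms(11) by (intro mult_left_mono mittag_leffler_mono powr_mono2) auto
    finally show ?thesis by (simp add: T_def clock_def mult.commute)
  qed
  then show ?thesis
    using assms(2) by (intro cSUP_least) auto
qed

end
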